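(* For every integer $k\ge 3$ there exists a simple nested fractal $\mathcal{K}^{\langle 0\rangle}$ in $\mathbb{R}^2$ with exactly $k$ essential fixed points such that the corresponding unbounded simple nested fractal $\mathcal{K}^{\langle\infty\rangle}$ has the good labelling property (GLP).
   Context: Simple nested fractal (SNF). Let $\Psi_i:\mathbb{R}^2\to\mathbb{R}^2$, $\Psi_i(x)=x/L+\nu_i$, $i=1,\dots,N$, with $L>1$, $\nu_i\in\mathbb{R}^2$, and one of the $\nu_i$ equal to $0$. $\mathcal{K}^{\langle 0\rangle}$ is the unique nonempty compact set with $\mathcal{K}^{\langle 0\rangle}=\bigcup_{i=1}^N\Psi_i(\mathcal{K}^{\langle 0\rangle})$. Let $F$ be the set of fixed points of the $\Psi_i$. A point $x\in F$ is an essential fixed point if there are another fixed point $y\in F$ and two different maps $\Psi_i,\Psi_j$ with $\Psi_i(x)=\Psi_j(y)$. $V_0^{\langle 0\rangle}$ is the set of essential fixed points and $k=\#V_0^{\langle 0\rangle}$. $\mathcal{K}^{\langle 0\rangle}$ is an SNF if: (1) $k\ge 2$; (2) (Open Set Condition) there is an open $U\subset\mathbb{R}^2$ with $\Psi_i(U)\cap\Psi_j(U)=\emptyset$ for $i\ne j$ and $\bigcup_i\Psi_i(U)\subseteq U$; (3) (Nesting) $\Psi_i(\mathcal{K}^{\langle 0\rangle})\cap\Psi_j(\mathcal{K}^{\langle 0\rangle})=\Psi_i(V_0^{\langle 0\rangle})\cap\Psi_j(V_0^{\langle 0\rangle})$ for $i\neq j$; (4) (Symmetry) for $x,y\in V_0^{\langle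 0\rangle}$ let $S_{x,y}$ be the reflection in the line perpendicularly bisecting $[x,y]$; for all $i\in\{1,\dots,N\}$ and all $x,y\in V_0^{\langle 0\rangle}$ there is $j\in\{1,\dots,N\}$ with $S_{x,y}(\Psi_i(V_0^{\langle 0\rangle}))=\Psi_j(V_0^{\langle 0\rangle})$; (5) (Connectivity) the graph on $V_{-1}^{\langle 0\rangle}=\bigcup_i\Psi_i(V_0^{\langle 0\rangle})$ in which $x,y$ are joined iff $x,y\in\Psi_i(\mathcal{K}^{\langle 0\rangle})$ for some $i$ is connected. For $k\ge 3$ it is known that $V_0^{\langle 0\rangle}$ is the vertex set of a regular $k$-gon. Complexes. $\mathcal{K}^{\langle M\rangle}=L^M\mathcal{K}^{\langle 0\rangle}$ and $\mathcal{K}^{\langle\infty\rangle}=\bigcup_{M\ge 0}\mathcal{K}^{\langle M\rangle}$ (the unbounded SNF). A $0$-complex is a set $\Delta_0=\mathcal{K}^{\langle 0\rangle}+\nu_{\Delta_0}\subset\mathcal{K}^{\langle\infty\rangle}$ with $\nu_{\Delta_0}=\sum_{j=1}^{J}L^j\nu_{i_j}$, $J\ge 1$, $\nu_{i_j}\in\{\nu_1,\dots,\nu_N\}$; its vertex set is $V(\Delta_0)=V_0^{\langle 0\rangle}+\nu_{\Delta_0}$. $V_0^{\langle\infty\rangle}$ is the set of vertices of all $0$-complexes. GLP. Let $\mathcal{A}$ be a set of $k$ labels, and let $\mathcal{R}_0$ be the set of the $k$ rotations around the barycenter of $\mathcal{K}^{\langle 0\rangle}$ mapping $V_0^{\langle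 0\rangle}$ onto itself. $\mathcal{K}^{\langle\infty\rangle}$ has the GLP if there is $\ell:V_0^{\langle\infty\rangle}\to\mathcal{A}$ whose restriction to $V_0^{\langle 0\rangle}$ is a bijection onto $\mathcal{A}$ and such that for every $0$-complex $\Delta_0=\mathcal{K}^{\langle 0\rangle}+\nu_{\Delta_0}$ there is $R_{\Delta_0}\in\mathcal{R}_0$ with $\ell(v)=\ell(R_{\Delta_0}(v-\nu_{\Delta_0}))$ for all $v\in V(\Delta_0)$. (By self-similarity the analogous property for complexes of any other scale $L^M$, $M\in\mathbb{Z}$, is equivalent.) *)

theory Defs
  imports "HOL-Analysis.Analysis"
begin

text \<open>
  The Euclidean plane is rendered by the type \<^typ>\<open>complex\<close>. A system of similitudes is given by
  the number of maps \<open>N\<close>, the common scaling factor \<open>L\<close>, and the translations \<open>\<nu> 1, \<dots>, \<nu> N\<close>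
  (values of \<open>\<nu>\<close> outside \<open>{1..N}\<close> are irrelevant).
\<close>

definition Psi :: "real \<Rightarrow> (nat \<Rightarrow> complex) \<Rightarrow> nat \<Rightarrow> complex \<Rightarrow> complex" where
  "Psi L \<nu> i x = x /\<^sub>R L + \<nu> i"

text \<open>For \<open>L > 1\<close> and \<open>N \<ge> 1\<close> the set described below exists and is unique (Hutchinson).\<close>

definition attractor :: "nat \<Rightarrow> real \<Rightarrow> (nat \<Rightarrow> complex) \<Rightarrow> complex set" where
  "attractor N L \<nu> = (THE K. compact K \<and> K \<noteq> {} \<and> K = (\<Union>i\<in>{1..N}. Psi L \<nu> i ` K))"

definition fixed_points :: "nat \<Rightarrow> real \<Rightarrow> (nat \<Rightarrow> complex) \<Rightarrow> complex set" where
  "fixed_points N L \<nu> = {x. \<exists>i\<in>{1..N}. Psi L \<nu> i x = x}"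

definition essential_fixed_points :: "nat \<Rightarrow> real \<Rightarrow> (nat \<Rightarrow> complex) \<Rightarrow> complex set" where
  "essential_fixed_points N L \<nu> =
     {x \<in> fixed_points N L \<nu>. \<exists>y\<in>fixed_points N L \<nu>. y \<noteq> x \<and>
        (\<exists>i\<in>{1..N}. \<exists>j\<in>{1..N}. Psi L \<nu> i \<noteq> Psi L \<nu> j \<and> Psi L \<nu> i x = Psi L \<nu> j y)}"

definition open_set_condition :: "nat \<Rightarrow> real \<Rightarrow> (nat \<Rightarrow> complex) \<Rightarrow> bool" where
  "open_set_condition N L \<nu> \<longleftrightarrow>
     (\<exists>U. open U \<and> U \<noteq> {} \<and>
          (\<forall>i\<in>{1..N}. \<forall>j\<in>{1..N}. i \<noteq> j \<longrightarrow> Psi L \<nu> i ` U \<inter> Psi L \<nu> j ` U = {}) \<and>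
          (\<Union>i\<in>{1..N}. Psi L \<nu> i ` U) \<subseteq> U)"

definition nesting :: "nat \<Rightarrow> real \<Rightarrow> (nat \<Rightarrow> complex) \<Rightarrow> bool" where
  "nesting N L \<nu> \<longleftrightarrow>
     (\<forall>i\<in>{1..N}. \<forall>j\<in>{1..N}. i \<noteq> j \<longrightarrow>
        Psi L \<nu> i ` attractor N L \<nu> \<inter> Psi L \<nu> j ` attractor N L \<nu> =
        Psi L \<nu> i ` essential_fixed_points N L \<nu> \<inter> Psi L \<nu> j ` essential_fixed_points N L \<nu>)"

text \<open>The reflection in the perpendicular bisector of the segment from \<open>x\<close> to \<open>y\<close>, for \<open>x \<noteq> y\<close>.\<close>

definition bisector_reflection :: "complex \<Rightarrow> complex \<Rightarrow> complex \<Rightarrow> complex" where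
  "bisector_reflection x y z =
     z - (2 * ((z - midpoint x y) \<bullet> (y - x)) / (norm (y - x))\<^sup>2) *\<^sub>R (y - x)"

definition symmetry :: "nat \<Rightarrow> real \<Rightarrow> (nat \<Rightarrow> complex) \<Rightarrow> bool" where
  "symmetry N L \<nu> \<longleftrightarrow>
     (\<forall>i\<in>{1..N}. \<forall>x\<in>essential_fixed_points N L \<nu>. \<forall>y\<in>essential_fixed_points N L \<nu>. x \<noteq> y \<longrightarrow>
        (\<exists>j\<in>{1..N}. bisector_reflection x y ` (Psi L \<nu> i ` essential_fixed_points N L \<nu>) =
                    Psi L \<nu> j ` essential_fixed_points N L \<nu>))"

definition connectivity :: "nat \<Rightarrow> real \<Rightarrow> (nat \<Rightarrow> complex) \<Rightarrow> bool" where
  "connectivity N L \<nu> \<longleftrightarrow>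
     (let V = (\<Union>i\<in>{1..N}. Psi L \<nu> i ` essential_fixed_points N L \<nu>);
          E = {(x, y). x \<in> V \<and> y \<in> V \<and>
                 (\<exists>i\<in>{1..N}. x \<in> Psi L \<nu> i ` attractor N L \<nu> \<and> y \<in> Psi L \<nu> i ` attractor N L \<nu>)}
      in \<forall>x\<in>V. \<forall>y\<in>V. (x, y) \<in> E\<^sup>*)"

definition simple_nested_fractal :: "nat \<Rightarrow> real \<Rightarrow> (nat \<Rightarrow> complex) \<Rightarrow> bool" where
  "simple_nested_fractal N L \<nu> \<longleftrightarrow>
     L > 1 \<and> (\<exists>i\<in>{1..N}. \<nu> i = 0) \<and>
     card (essential_fixed_points N L \<nu>) \<ge> 2 \<and>
     open_set_condition N L \<nu> \<and> nesting N L \<nu> \<and> symmetry N L \<nu> \<and> connectivity N L \<nu>"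

definition unbounded_fractal :: "nat \<Rightarrow> real \<Rightarrow> (nat \<Rightarrow> complex) \<Rightarrow> complex set" where
  "unbounded_fractal N L \<nu> = (\<Union>M::nat. (\<lambda>x. L ^ M *\<^sub>R x) ` attractor N L \<nu>)"

text \<open>
  A \<open>0\<close>-complex is represented by its translation vector, which it determines, the attractor
  being compact and nonempty.
\<close>

definition complex_shifts :: "nat \<Rightarrow> real \<Rightarrow> (nat \<Rightarrow> complex) \<Rightarrow> complex set" where
  "complex_shifts N L \<nu> =
     {s. (\<exists>J w. J \<ge> 1 \<and> (\<forall>j\<in>{1..J}. w j \<in> {1..N}) \<and> s = (\<Sum>j=1..J. L ^ j *\<^sub>R \<nu> (w j))) \<and>
         (\<lambda>x. x + s) ` attractor N L \<nu> \<subseteq> unbounded_fractal N L \<nu>}"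

definition complex_vertices :: "nat \<Rightarrow> real \<Rightarrow> (nat \<Rightarrow> complex) \<Rightarrow> complex \<Rightarrow> complex set" where
  "complex_vertices N L \<nu> s = (\<lambda>x. x + s) ` essential_fixed_points N L \<nu>"

definition unbounded_vertices :: "nat \<Rightarrow> real \<Rightarrow> (nat \<Rightarrow> complex) \<Rightarrow> complex set" where
  "unbounded_vertices N L \<nu> = (\<Union>s\<in>complex_shifts N L \<nu>. complex_vertices N L \<nu> s)"

text \<open>
  The barycenter of the fractal is taken to be the centroid of its essential fixed points, i.e. the
  center of the regular polygon they form. A rotation that permutes the essential fixed points
  fixes their centroid, so no other point can be the center of a nontrivial such rotation.
\<close>

definition barycenter :: "nat \<Rightarrow> real \<Rightarrow> (nat \<Rightarrow> complex) \<Rightarrow> complex" where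
  "barycenter N L \<nu> =
     (\<Sum>v\<in>essential_fixed_points N L \<nu>. v) /\<^sub>R real (card (essential_fixed_points N L \<nu>))"

definition vertex_rotations :: "nat \<Rightarrow> real \<Rightarrow> (nat \<Rightarrow> complex) \<Rightarrow> (complex \<Rightarrow> complex) set" where
  "vertex_rotations N L \<nu> =
     {R. (\<exists>\<theta>. R = (\<lambda>z. barycenter N L \<nu> + cis \<theta> * (z - barycenter N L \<nu>))) \<and>
         R ` essential_fixed_points N L \<nu> = essential_fixed_points N L \<nu>}"

text \<open>
  The labels are \<open>0, \<dots>, k - 1\<close> with \<open>k\<close> the number of essential fixed points; the property does
  not depend on the choice of the \<open>k\<close>-element label set.
\<close>

definition good_labelling_property :: "nat \<Rightarrow> real \<Rightarrow> (nat \<Rightarrow> complex) \<Rightarrow> bool" where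
  "good_labelling_property N L \<nu> \<longleftrightarrow>
     (\<exists>l :: complex \<Rightarrow> nat.
        l ` unbounded_vertices N L \<nu> \<subseteq> {..<card (essential_fixed_points N L \<nu>)} \<and>
        bij_betw l (essential_fixed_points N L \<nu>) {..<card (essential_fixed_points N L \<nu>)} \<and>
        (\<forall>s\<in>complex_shifts N L \<nu>. \<exists>R\<in>vertex_rotations N L \<nu>.
           \<forall>v\<in>complex_vertices N L \<nu> s. l v = l (R (v - s))))"

end

theory Submission
  imports Defs
begin

text \<open>
  Place the vertices at the \<open>k\<close>-th roots of unity, let \<open>d\<close> be the diameter of this set, and shrink by \<open>L\<close>.
  By strict convexity of balls, points of the polygon at distance \<open>d\<close> are vertices. Hence, as soon as
  the centers of distinct cells are at least \<open>d / L\<close> apart, cells meet in vertices only, which gives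
  both the nesting axiom and the open set condition.

  If \<open>4\<close> does not divide \<open>k\<close>, there is an odd \<open>h\<close> such that the chord from \<open>1\<close> to the \<open>h\<close>-th power of
  \<open>cis (2 * pi / k)\<close> has length \<open>d\<close>, and it is parallel to a side up to rotation by a root of unity
  because \<open>h\<close> is odd; so a ring of \<open>k\<close> corner cells closes up, each touching the next one in a vertex.
  If \<open>4\<close> divides \<open>k\<close>, such cells would share sides, and consecutive corner cells are instead joined by
  an intermediate cell which touches both in antipodal vertices (for \<open>k = 4\<close> the four intermediate
  cells coincide, and one obtains the Vicsek fractal).

  Label vertices by roots of unity. Rotating the labels of the \<open>j\<close>-th corner cell by \<open>h * j\<close> steps
  (first case), or those of the intermediate cells by a half turn (second case), makes the labels of
  touching cells agree. The labels at the corners of a complex are then a fixed power of the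
  original ones, so the labelling extends consistently through all scales.
\<close>

subsection \<open>Systems of cells that touch in vertices\<close>

lemma Psi_image_contraction:
  assumes "L > 1" shows "dist (Psi L \<nu> i x) (Psi L \<nu> i y) = dist x y / L"
proof -
  have "Psi L \<nu> i x - Psi L \<nu> i y = (x - y) /\<^sub>R L"
    by (simp add: Psi_def scaleR_diff_right)
  then show ?thesis
    using assms by (simp add: dist_norm divide_inverse_commute)
qed

lemma inj_Psi: "L > 1 \<Longrightarrow> inj (Psi L \<nu> i)"
  by (auto simp: inj_def Psi_def)

lemma continuous_on_Psi: "continuous_on A (Psi L \<nu> i)"
  unfolding Psi_def by (intro continuous_intros)

text \<open>A point of \<open>K\<close> farthest from \<open>K'\<close> is the image of some point
  of \<open>K\<close>. The map sends the nearest point of \<open>K'\<close> back into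
  \<open>K'\<close> and shrinks the distance by the factor \<open>L\<close>, so the maximal distance
  is zero.\<close>

lemma invariant_compact_subset:
  fixes K K' :: "complex set"
  assumes "L > 1" "compact K" "K \<noteq> {}" "K = (\<Union>i\<in>I. Psi L \<nu> i ` K)"
    and "compact K'" "K' \<noteq> {}" "K' = (\<Union>i\<in>I. Psi L \<nu> i ` K')"
  shows "K \<subseteq> K'"
proof -
  have "continuous_on K (\<lambda>x. infdist x K')"
    by (intro continuous_intros)
  then obtain x where x: "x \<in> K" "\<And>y. y \<in> K \<Longrightarrow> infdist y K' \<le> infdist x K'"
    using continuous_attains_sup[OF assms(2,3)] by blast
  obtain i y where i: "i \<in> I" "y \<in> K" "x = Psi L \<nu> i y"
    using x(1) assms(4) by blast
  obtain z where z: "z \<in> K'" "infdist y K' = dist y z"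
    using infdist_attains_inf[of K' y] assms by (auto simp: compact_imp_closed)
  have "infdist x K' \<le> dist x (Psi L \<nu> i z)"
    using z i assms(7) by (intro infdist_le) blast
  also have "\<dots> = infdist y K' / L"
    using assms(1) i z by (simp add: Psi_image_contraction)
  also have "\<dots> \<le> infdist x K' / L"
    using x(2)[OF i(2)] assms(1) by (simp add: divide_right_mono)
  finally have "infdist x K' * (L - 1) \<le> 0"
    using assms(1) by (simp add: field_simps)
  then have 0: "infdist x K' \<le> 0"
    using assms(1) by (simp add: mult_le_0_iff)
  show ?thesis
  proof
    fix y assume "y \<in> K"
    then have "infdist y K' = 0"
      using 0 x(2)[of y] infdist_nonneg[of y K'] by linarith
    then show "y \<in> K'"
      using in_closed_iff_infdist_zero[of K' y] assms by (simp add: compact_imp_closed)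
  qed
qed

lemma attractor_eqI:
  assumes "L > 1" "compact K" "K \<noteq> {}" "K = (\<Union>i\<in>{1..N}. Psi L \<nu> i ` K)"
  shows "attractor N L \<nu> = K"
  unfolding attractor_def
proof (rule the_equality)
  show "compact K \<and> K \<noteq> {} \<and> K = (\<Union>i\<in>{1..N}. Psi L \<nu> i ` K)"
    using assms by blast
next
  fix K' assume K': "compact K' \<and> K' \<noteq> {} \<and> K' = (\<Union>i\<in>{1..N}. Psi L \<nu> i ` K')"
  show "K' = K"
    using invariant_compact_subset[OF assms, of K']
      invariant_compact_subset[where K = K' and K' = K and I = "{1..N}" and L = L and \<nu> = \<nu>] K' assms
    by blast
qed

text \<open>The attractor is built as the intersection of the decreasing iterates of
  \<open>P\<close> under the union of the maps. The fixed points in \<open>V\<close> survive every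
  iterate and make the intersection nonempty.\<close>

lemma attractor_between:
  fixes V P :: "complex set"
  assumes L: "L > 1" and P: "compact P" "V \<subseteq> P" and ne: "V \<noteq> {}"
    and into: "\<And>i. i \<in> {1..N} \<Longrightarrow> Psi L \<nu> i ` P \<subseteq> P"
    and fp: "\<And>v. v \<in> V \<Longrightarrow> \<exists>i\<in>{1..N}. Psi L \<nu> i v = v"
  shows "V \<subseteq> attractor N L \<nu>" "attractor N L \<nu> \<subseteq> P"
    "attractor N L \<nu> = (\<Union>i\<in>{1..N}. Psi L \<nu> i ` attractor N L \<nu>)"
proof -
  define \<Phi> where "\<Phi> A = (\<Union>i\<in>{1..N}. Psi L \<nu> i ` A)" for A
  define F where "F n = (\<Phi> ^^ n) P" for n
  define K where "K = (\<Inter>n. F n)"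
  have mono: "A \<subseteq> B \<Longrightarrow> \<Phi> A \<subseteq> \<Phi> B" for A B
    unfolding \<Phi>_def by blast
  have V\<Phi>: "V \<subseteq> A \<Longrightarrow> V \<subseteq> \<Phi> A" for A
    unfolding \<Phi>_def using fp by force
  have VF: "V \<subseteq> F n" for n
    by (induction n) (auto simp: F_def P(2) V\<Phi>[THEN subsetD])
  have comp: "compact (F n)" for n
    by (induction n)
      (auto simp: F_def P \<Phi>_def intro!: compact_UN compact_continuous_image continuous_on_Psi)
  have dec1: "F (Suc n) \<subseteq> F n" for n
  proof (induction n)
    case 0
    have "\<Phi> P \<subseteq> P" unfolding \<Phi>_def using into by (rule UN_least)
    then show ?case by (simp add: F_def)
  next
    case (Suc n)
    then show ?case using mono by (simp add: F_def)
  qed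
  have dec: "F n \<subseteq> F m" if "m \<le> n" for m n
    using that dec1 lift_Suc_antimono_le by blast
  have "compact K"
    unfolding K_def using comp by (intro compact_Inter) auto
  moreover have VK: "V \<subseteq> K"
    using VF by (auto simp: K_def)
  moreover have "K = \<Phi> K"
  proof
    have "\<Phi> K \<subseteq> F n" for n
    proof -
      have "\<Phi> K \<subseteq> \<Phi> (F n)" by (rule mono) (auto simp: K_def)
      also have "\<dots> = F (Suc n)" by (simp add: F_def)
      finally show ?thesis using dec1 by blast
    qed
    then show "\<Phi> K \<subseteq> K" by (auto simp: K_def)
    show "K \<subseteq> \<Phi> K"
    proof
      fix x assume x: "x \<in> K"
      \<comment> \<open>As the sets decrease, one of the finitely many maps serves for all of them.\<close>
      have "\<exists>i\<in>{1..N}. \<forall>n. x \<in> Psi L \<nu> i ` F n"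
      proof (rule ccontr)
        assume "\<not> ?thesis"
        then obtain n where n: "\<And>i. i \<in> {1..N} \<Longrightarrow> x \<notin> Psi L \<nu> i ` F (n i)"
          by metis
        define m where "m = Max (insert 0 (n ` {1..N}))"
        have "x \<notin> Psi L \<nu> i ` F m" if "i \<in> {1..N}" for i
        proof -
          have "n i \<le> m" unfolding m_def using that by (intro Max_ge) auto
          then show ?thesis using n[OF that] dec by blast
        qed
        then have "x \<notin> F (Suc m)" by (simp add: F_def \<Phi>_def)
        then show False using x by (auto simp: K_def)
      qed
      then obtain i where i: "i \<in> {1..N}" "\<And>n. x \<in> Psi L \<nu> i ` F n" by blast
      then obtain y where y: "x = Psi L \<nu> i y" by blast
      have "y \<in> F n" for n
        using i(2)[of n] y inj_Psi[OF L] by (metis imageE injD)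
      then have "y \<in> K" by (simp add: K_def)
      then show "x \<in> \<Phi> K" using i(1) y unfolding \<Phi>_def by blast
    qed
  qed
  ultimately have K: "attractor N L \<nu> = K"
    using ne by (intro attractor_eqI[OF L]) (auto simp: \<Phi>_def)
  show "V \<subseteq> attractor N L \<nu>" using K VK by simp
  show "attractor N L \<nu> = (\<Union>i\<in>{1..N}. Psi L \<nu> i ` attractor N L \<nu>)"
    using K \<open>K = \<Phi> K\<close> by (simp add: \<Phi>_def)
  show "attractor N L \<nu> \<subseteq> P"
    unfolding K K_def by (rule INF_lower2[of 0]) (simp_all add: F_def)
qed

section \<open>Diametral pairs in convex hulls\<close>

text \<open>Balls are convex, and this is used twice: the hull lies in the ball around each
  generator, so every generator lies in the ball around \<open>y\<close>, and then so does the
  hull.\<close>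

lemma dist_le_in_convex_hull:
  fixes V :: "'a::real_normed_vector set"
  assumes "\<And>x y. x \<in> V \<Longrightarrow> y \<in> V \<Longrightarrow> dist x y \<le> d" "x \<in> convex hull V" "y \<in> convex hull V"
  shows "dist x y \<le> d"
proof -
  have *: "convex hull V \<subseteq> cball v d" if "v \<in> V" for v
    using assms(1)[OF that] by (intro hull_minimal) auto
  have "V \<subseteq> cball y d"
  proof
    fix v assume "v \<in> V"
    then show "v \<in> cball y d" using *[of v] assms(3) by (auto simp: dist_commute)
  qed
  then have "convex hull V \<subseteq> cball y d"
    by (intro hull_minimal) auto
  then show ?thesis using assms(2) by (auto simp: dist_commute)
qed

lemma extreme_point_of_cball:
  fixes x :: "'a::euclidean_space"
  assumes "dist c x = r" shows "x extreme_point_of cball c r"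
  unfolding extreme_point_of_def
  using assms dist_decreases_open_segment[of x _ _ c] by force

text \<open>The hull lies in the ball of radius \<open>d\<close> around \<open>y\<close>, with
  \<open>x\<close> on the sphere. Points of the sphere are extreme in the ball, hence
  \<open>x\<close> is extreme in the hull, and extreme points of a hull are generators.\<close>

lemma diametral_in_convex_hull:
  fixes V :: "'a::euclidean_space set"
  assumes "\<And>x y. x \<in> V \<Longrightarrow> y \<in> V \<Longrightarrow> dist x y \<le> d" "x \<in> convex hull V" "y \<in> convex hull V"
    and "d \<le> dist x y"
  shows "x \<in> V"
proof -
  have eq: "dist y x = d"
    using assms dist_le_in_convex_hull[of V d x y] by (simp add: dist_commute)
  have "convex hull V \<subseteq> cball y d"
    using dist_le_in_convex_hull[of V d y] assms by auto
  then have "x extreme_point_of convex hull V"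
    using extreme_point_of_cball[OF eq] assms(2) by (auto simp: extreme_point_of_def)
  then show ?thesis by (rule extreme_point_of_convex_hull)
qed

section \<open>The fractal axioms from separation of cells\<close>

text \<open>\<open>fixed\<close> ensures that every map sends the hull into itself.
  \<open>separated\<close> keeps cells from overlapping in more than vertices. \<open>touch\<close>
  makes every vertex an essential fixed point.\<close>

locale touching_system =
  fixes N :: nat and L :: real and \<nu> :: "nat \<Rightarrow> complex" and V :: "complex set" and d :: real
  assumes L: "L > 1"
    and finV: "finite V"
    and extreme: "\<And>v. v \<in> V \<Longrightarrow> v extreme_point_of convex hull V"
    and diam: "\<And>u v. u \<in> V \<Longrightarrow> v \<in> V \<Longrightarrow> dist u v \<le> d"
    and separated: "\<And>i j. i \<in> {1..N} \<Longrightarrow> j \<in> {1..N} \<Longrightarrow> i \<noteq> j \<Longrightarrow> d \<le> L * dist (\<nu> i) (\<nu> j)"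
    and dpos: "d > 0"
    and corner: "\<And>v. v \<in> V \<Longrightarrow> \<exists>i\<in>{1..N}. Psi L \<nu> i v = v"
    and fixed: "\<And>i. i \<in> {1..N} \<Longrightarrow> \<exists>p\<in>convex hull V. Psi L \<nu> i p = p"
    and touch: "\<And>v. v \<in> V \<Longrightarrow> \<exists>w\<in>V. \<exists>i\<in>{1..N}. \<exists>j\<in>{1..N}. i \<noteq> j \<and> Psi L \<nu> i v = Psi L \<nu> j w"
    and nonempty_V: "V \<noteq> {}"
begin

abbreviation "P \<equiv> convex hull V"

lemma Psi_eq_combination:
  assumes "Psi L \<nu> i p = p" shows "Psi L \<nu> i x = (1 - 1 / L) *\<^sub>R p + (1 / L) *\<^sub>R x"
proof -
  have "\<nu> i = p - p /\<^sub>R L" using assms by (simp add: Psi_def algebra_simps)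
  then show ?thesis
    by (simp add: Psi_def scaleR_diff_left divide_inverse algebra_simps)
qed

lemma Psi_into: "i \<in> {1..N} \<Longrightarrow> Psi L \<nu> i ` P \<subseteq> P"
proof clarify
  fix x assume "i \<in> {1..N}" "x \<in> P"
  then obtain p where p: "p \<in> P" "Psi L \<nu> i p = p" using fixed by blast
  show "Psi L \<nu> i x \<in> P"
    unfolding Psi_eq_combination[OF p(2)]
    using L \<open>x \<in> P\<close> p(1) by (intro convexD) auto
qed

lemma attractor_facts:
  "V \<subseteq> attractor N L \<nu>" "attractor N L \<nu> \<subseteq> P"
  using attractor_between[OF L, of P V N \<nu>] finV nonempty_V Psi_into corner
  by (auto simp: hull_subset finite_imp_compact_convex_hull)

lemma overlap_dist:
  assumes "i \<in> {1..N}" "j \<in> {1..N}" "i \<noteq> j" "Psi L \<nu> i x = Psi L \<nu> j y"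
  shows "d \<le> dist x y"
proof -
  have "(x - y) /\<^sub>R L = \<nu> j - \<nu> i"
    using assms(4) by (simp add: Psi_def algebra_simps)
  then have "norm (x - y) / L = norm (\<nu> j - \<nu> i)"
    using L by (metis (no_types) abs_of_pos divide_inverse_commute inverse_positive_iff_positive
        less_trans norm_scaleR zero_less_one)
  then have "dist x y = L * dist (\<nu> i) (\<nu> j)"
    using L by (simp add: dist_norm norm_minus_commute field_simps)
  then show ?thesis using separated[OF assms(1-3)] by simp
qed

text \<open>The two preimages of a common point of distinct cells are at least \<open>d\<close>
  apart, while \<open>d\<close> also bounds all distances in the hull. So they form a diametral
  pair, and they differ because \<open>d\<close> is positive.\<close>

lemma overlap_vertices:
  assumes "i \<in> {1..N}" "j \<in> {1..N}" "i \<noteq> j" "Psi L \<nu> i x = Psi L \<nu> j y" "x \<in> P" "y \<in> P"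
  shows "x \<in> V" "y \<in> V" "x \<noteq> y"
  using overlap_dist[OF assms(1-4)] diametral_in_convex_hull[of V d x y]
    diametral_in_convex_hull[of V d y x] diam assms dpos
  by (auto simp: dist_commute)

lemma Psi_distinct: "i \<in> {1..N} \<Longrightarrow> j \<in> {1..N} \<Longrightarrow> i \<noteq> j \<Longrightarrow> Psi L \<nu> i \<noteq> Psi L \<nu> j"
  using overlap_dist[of i j 0 0] dpos by auto

text \<open>All fixed points lie in the hull, so the coincidence demanded of an essential one is an
  overlap of cells and forces a vertex. Conversely, \<open>touch\<close> supplies the partner of a
  vertex, which is distinct from it by \<open>overlap_vertices\<close>.\<close>

lemma essential: "essential_fixed_points N L \<nu> = V"
proof
  have uniq: "p = q" if "Psi L \<nu> i p = p" "Psi L \<nu> i q = q" for i p q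
    using Psi_image_contraction[OF L, of \<nu> i p q] that L dist_not_less_zero[of p q]
    by (cases "p = q") (auto simp: field_simps)
  have F: "fixed_points N L \<nu> \<subseteq> P"
  proof
    fix x assume "x \<in> fixed_points N L \<nu>"
    then obtain i where i: "i \<in> {1..N}" "Psi L \<nu> i x = x" unfolding fixed_points_def by auto
    then obtain p where "p \<in> P" "Psi L \<nu> i p = p" using fixed by blast
    then show "x \<in> P" using uniq i(2) by metis
  qed
  show "essential_fixed_points N L \<nu> \<subseteq> V"
  proof
    fix x assume "x \<in> essential_fixed_points N L \<nu>"
    then obtain y i j where *: "x \<in> fixed_points N L \<nu>" "y \<in> fixed_points N L \<nu>"
      "i \<in> {1..N}" "j \<in> {1..N}" "Psi L \<nu> i \<noteq> Psi L \<nu> j" "Psi L \<nu> i x = Psi L \<nu> j y"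
      unfolding essential_fixed_points_def by auto
    then have "i \<noteq> j" by auto
    then show "x \<in> V"
      using overlap_vertices(1)[OF *(3,4) _ *(6)] *(1,2) F by auto
  qed
  have VF: "V \<subseteq> fixed_points N L \<nu>"
    unfolding fixed_points_def using corner by blast
  show "V \<subseteq> essential_fixed_points N L \<nu>"
  proof
    fix v assume v: "v \<in> V"
    then obtain w i j where "w \<in> V" "i \<in> {1..N}" "j \<in> {1..N}" "i \<noteq> j" "Psi L \<nu> i v = Psi L \<nu> j w"
      using touch by blast
    moreover from this have "v \<noteq> w"
      using v overlap_vertices(3)[of i j v w] by (simp add: hull_inc)
    moreover have "v \<in> fixed_points N L \<nu>" "w \<in> fixed_points N L \<nu>"
      using VF v \<open>w \<in> V\<close> by auto
    ultimately show "v \<in> essential_fixed_points N L \<nu>"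
      unfolding essential_fixed_points_def using Psi_distinct[of i j] by force
  qed
qed

lemma nesting: "nesting N L \<nu>"
proof -
  have "Psi L \<nu> i ` attractor N L \<nu> \<inter> Psi L \<nu> j ` attractor N L \<nu> = Psi L \<nu> i ` V \<inter> Psi L \<nu> j ` V"
    if "i \<in> {1..N}" "j \<in> {1..N}" "i \<noteq> j" for i j
  proof
    show "Psi L \<nu> i ` attractor N L \<nu> \<inter> Psi L \<nu> j ` attractor N L \<nu> \<subseteq> Psi L \<nu> i ` V \<inter> Psi L \<nu> j ` V"
    proof clarify
      fix z x y assume *: "x \<in> attractor N L \<nu>" "y \<in> attractor N L \<nu>" "Psi L \<nu> i x = Psi L \<nu> j y"
      then have "x \<in> V" "y \<in> V"
        using attractor_facts(2) overlap_vertices[OF that *(3)] by auto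
      then show "Psi L \<nu> i x \<in> Psi L \<nu> i ` V \<inter> Psi L \<nu> j ` V" using *(3) by blast
    qed
  qed (use attractor_facts(1) in blast)
  then show ?thesis unfolding nesting_def essential by auto
qed

text \<open>The interior of the polygon serves as the open set: an overlap would put a vertex, which
  is an extreme point, into the interior.\<close>

lemma open_set_condition:
  assumes "interior P \<noteq> {}" shows "open_set_condition N L \<nu>"
  unfolding open_set_condition_def
proof (intro exI conjI ballI impI)
  fix i j assume ij: "i \<in> {1..N}" "j \<in> {1..N}" "i \<noteq> j"
  show "Psi L \<nu> i ` interior P \<inter> Psi L \<nu> j ` interior P = {}"
  proof (rule ccontr)
    assume "Psi L \<nu> i ` interior P \<inter> Psi L \<nu> j ` interior P \<noteq> {}"
    then obtain x y where xy: "x \<in> interior P" "y \<in> interior P" "Psi L \<nu> i x = Psi L \<nu> j y" by auto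
    then have "x \<in> P" "y \<in> P" using interior_subset by auto
    then have "x extreme_point_of P"
      using overlap_vertices(1)[OF ij xy(3)] extreme by auto
    then show False using xy(1) extreme_point_not_in_interior by blast
  qed
next
  show "(\<Union>i\<in>{1..N}. Psi L \<nu> i ` interior P) \<subseteq> interior P"
  proof (rule UN_least)
    fix i assume i: "i \<in> {1..N}"
    have "open (Psi L \<nu> i ` interior P)"
    proof -
      have "Psi L \<nu> i ` interior P = (\<lambda>x. \<nu> i + x) ` (\<lambda>x. inverse L *\<^sub>R x) ` interior P"
        by (simp add: image_image Psi_def add.commute)
      then show ?thesis using L by (simp add: open_translation open_scaling)
    qed
    moreover have "Psi L \<nu> i ` interior P \<subseteq> P"
      using Psi_into[OF i] interior_subset by blast
    ultimately show "Psi L \<nu> i ` interior P \<subseteq> interior P" by (simp add: interior_maximal)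
  qed
qed (use assms in auto)

text \<open>All vertices of one cell are joined to each other, so it suffices that the graph of
  cells sharing a vertex is connected.\<close>

lemma connectivity:
  assumes "\<And>i j. i \<in> {1..N} \<Longrightarrow> j \<in> {1..N} \<Longrightarrow>
    (i, j) \<in> {(i, j). i \<in> {1..N} \<and> j \<in> {1..N} \<and> Psi L \<nu> i ` V \<inter> Psi L \<nu> j ` V \<noteq> {}}\<^sup>*"
  shows "connectivity N L \<nu>"
proof -
  define W where "W = (\<Union>i\<in>{1..N}. Psi L \<nu> i ` V)"
  define E where "E = {(x, y). x \<in> W \<and> y \<in> W \<and>
    (\<exists>i\<in>{1..N}. x \<in> Psi L \<nu> i ` attractor N L \<nu> \<and> y \<in> Psi L \<nu> i ` attractor N L \<nu>)}"
  have E: "(x, y) \<in> E" if "i \<in> {1..N}" "x \<in> Psi L \<nu> i ` V" "y \<in> Psi L \<nu> i ` V" for x y i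
    using that attractor_facts(1) unfolding E_def W_def by blast
  have "(x, y) \<in> E\<^sup>*" if x: "x \<in> Psi L \<nu> i ` V" "i \<in> {1..N}" and y: "y \<in> Psi L \<nu> j ` V" "j \<in> {1..N}"
    for x y i j
    using assms[OF x(2) y(2)] y(1)
  proof (induction arbitrary: y rule: rtrancl_induct)
    case base
    then show ?case using E x by blast
  next
    case (step j m)
    then obtain z where z: "z \<in> Psi L \<nu> j ` V" "z \<in> Psi L \<nu> m ` V" "m \<in> {1..N}" by blast
    have "(z, y) \<in> E" using E z step by blast
    then show ?case using step.IH[OF z(1)] by (simp add: rtrancl.rtrancl_into_rtrancl)
  qed
  then have "\<forall>x\<in>W. \<forall>y\<in>W. (x, y) \<in> E\<^sup>*" unfolding W_def by blast
  then show ?thesis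
    unfolding connectivity_def essential Let_def W_def[symmetric] E_def[symmetric] .
qed

section \<open>Addresses of vertices across scales\<close>

text \<open>
  \<open>position w v J\<close> is the vertex \<open>v\<close> of the complex with address \<open>w 1, \<dots>, w J\<close>, scaled by \<open>L ^ -J\<close>.
\<close>

primrec position :: "(nat \<Rightarrow> nat) \<Rightarrow> complex \<Rightarrow> nat \<Rightarrow> complex" where
  "position w v 0 = v"
| "position w v (Suc J) = Psi L \<nu> (w (Suc J)) (position w v J)"

lemma position_eq: "L ^ J *\<^sub>R position w v J = v + (\<Sum>j=1..J. L ^ j *\<^sub>R \<nu> (w j))"
proof (induction J)
  case (Suc J)
  have "L ^ Suc J *\<^sub>R position w v (Suc J) = L ^ J *\<^sub>R position w v J + L ^ Suc J *\<^sub>R \<nu> (w (Suc J))"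
    using L by (simp add: Psi_def scaleR_add_right)
  then show ?case using Suc by simp
qed simp

lemma position_in_hull:
  "v \<in> V \<Longrightarrow> \<forall>j\<in>{1..J}. w j \<in> {1..N} \<Longrightarrow> position w v J \<in> P"
proof (induction J)
  case (Suc J)
  then have "Psi L \<nu> (w (Suc J)) ` P \<subseteq> P" by (intro Psi_into) auto
  then show ?case using Suc by auto
qed (simp add: hull_inc)

text \<open>The image \<open>p\<close> of \<open>x\<close> divides the segment from \<open>x\<close>
  to the fixed point \<open>q\<close> of the map. Being extreme, it cannot lie strictly inside, so
  all three points coincide.\<close>

lemma corner_position:
  assumes p: "p \<in> V" "Psi L \<nu> i x = p" "x \<in> P" and i: "i \<in> {1..N}"
  shows "x = p" "Psi L \<nu> i p = p"
proof -
  obtain q where q: "q \<in> P" "Psi L \<nu> i q = q" using fixed i by blast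
  have "p = q \<and> p = x"
  proof (cases "q = x")
    case False
    have "p \<in> open_segment q x"
      using p(2) L False unfolding Psi_eq_combination[OF q(2)] in_segment
      by (auto intro!: exI[of _ "1 / L"])
    then show ?thesis using extreme[OF p(1)] q(1) p(3) unfolding extreme_point_of_def by blast
  qed (use p q in auto)
  then show "x = p" "Psi L \<nu> i p = p" using q by auto
qed

end

subsection \<open>Labelling by roots of unity\<close>

abbreviation roots :: "nat \<Rightarrow> complex set" where "roots k \<equiv> {u. u ^ k = 1}"

lemma norm_root: "u \<in> roots k \<Longrightarrow> k > 0 \<Longrightarrow> norm u = 1"
proof -
  assume u: "u \<in> roots k" "k > 0"
  then have "norm u ^ k = 1" by (simp flip: norm_power)
  then show "norm u = 1" using u(2) power_eq_imp_eq_base[of "norm u" k 1] by simp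
qed

text \<open>
  Labels are \<open>k\<close>-th roots of unity. A complex with address \<open>w 1, \<dots>, w J\<close> carries the rotation
  \<open>\<Prod>j. a (w j) ^ (e ^ (j - 1))\<close>: within a complex of the next scale the map \<open>i\<close> contributes the
  factor \<open>a i\<close>, and by \<open>label_corner\<close> the vertices of the larger complex carry the \<open>e\<close>-th powers
  of the labels of the smaller one.
\<close>

locale labelled_system = touching_system N L \<nu> "(\<lambda>u. u - 1) ` {u. u ^ k = 1}" d
  for N L \<nu> k d +
  fixes a :: "nat \<Rightarrow> complex" and e i0 :: nat
  assumes k: "k \<ge> 3"
    and i0: "i0 \<in> {1..N}" "\<nu> i0 = 0" "a i0 = 1"
    and label_root: "\<And>i. i \<in> {1..N} \<Longrightarrow> a i ^ k = 1"
    and label_touch: "\<And>i j u v. \<lbrakk>i \<in> {1..N}; j \<in> {1..N}; i \<noteq> j; u ^ k = 1; v ^ k = 1;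
      Psi L \<nu> i (u - 1) = Psi L \<nu> j (v - 1)\<rbrakk> \<Longrightarrow> u * a i = v * a j"
    and label_corner: "\<And>i u. \<lbrakk>i \<in> {1..N}; u ^ k = 1; Psi L \<nu> i (u - 1) = u - 1\<rbrakk> \<Longrightarrow> u * a i = u ^ e"
begin

abbreviation "V \<equiv> (\<lambda>u. u - 1) ` {u::complex. u ^ k = 1}"

lemma in_V_iff: "v \<in> V \<longleftrightarrow> (v + 1) ^ k = 1"
  by (force simp: image_iff)

lemma card_V: "card V = k"
  using k by (subst card_image) (auto simp: inj_on_def card_roots_unity_eq)

lemma barycenter_eq: "barycenter N L \<nu> = - 1"
proof -
  have "(\<Sum>v\<in>V. v) = (\<Sum>u | u ^ k = 1. u - 1)"
    by (subst sum.reindex) (auto simp: inj_on_def)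
  also have "\<dots> = \<Sum>{u. u ^ k = 1} - of_nat (card {u::complex. u ^ k = 1})"
    by (simp add: sum_subtractf)
  also have "\<dots> = - of_nat k"
    using k by (simp add: sum_roots_unity card_roots_unity_eq)
  finally show ?thesis
    using k by (simp add: barycenter_def essential card_V scaleR_conv_of_real)
qed

definition turn :: "(nat \<Rightarrow> nat) \<Rightarrow> nat \<Rightarrow> complex" where
  "turn w J = (\<Prod>j=1..J. a (w j) ^ (e ^ (j - 1)))"

lemma turn_0 [simp]: "turn w 0 = 1" and turn_Suc: "turn w (Suc J) = turn w J * a (w (Suc J)) ^ (e ^ J)"
  by (simp_all add: turn_def)

lemma turn_root: "\<forall>j\<in>{1..J}. w j \<in> {1..N} \<Longrightarrow> turn w J ^ k = 1"
proof (induction J)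
  case (Suc J)
  have "(a (w (Suc J)) ^ k) ^ (e ^ J) = 1" using Suc by (simp add: label_root)
  then show ?case
    using Suc by (simp add: turn_Suc power_mult_distrib flip: power_mult) (simp add: mult.commute)
qed simp

text \<open>By \<open>corner_position\<close>, a vertex that ends up at a corner \<open>p\<close>
  already sits at \<open>p\<close> on every smaller scale. Each scale thus contributes one use of
  \<open>label_corner\<close>, raising the label to the power \<open>e\<close>.\<close>

lemma corner_label:
  assumes "v \<in> V" "\<forall>j\<in>{1..J}. w j \<in> {1..N}" "position w v J = p" "p \<in> V"
  shows "(v + 1) * turn w J = (p + 1) ^ (e ^ J)"
  using assms(2-)
proof (induction J arbitrary: p)
  case (Suc J)
  let ?i = "w (Suc J)"
  have i: "?i \<in> {1..N}" using Suc.prems by auto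
  have "position w v J \<in> P"
    using position_in_hull assms(1) Suc.prems by auto
  then have p: "position w v J = p" "Psi L \<nu> ?i p = p"
    using corner_position[of p ?i "position w v J"] Suc.prems i by auto
  then have "(v + 1) * turn w (Suc J) = ((p + 1) * a ?i) ^ (e ^ J)"
    using Suc by (simp add: turn_Suc power_mult_distrib mult.assoc[symmetric])
  also have "(p + 1) * a ?i = (p + 1) ^ e"
    using label_corner[OF i, of "p + 1"] p Suc.prems by (simp add: in_V_iff)
  finally show ?case by (simp add: power_mult)
qed simp

text \<open>Induction on the scale, comparing the outermost maps. If they agree, they cancel. If
  they differ, their cells meet in vertices, so both labels reduce by \<open>corner_label\<close> to
  corner labels, and the \<open>e ^ J\<close>-th power of \<open>label_touch\<close> equates
  them.\<close>

lemma label_well_defined: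
  assumes "v \<in> V" "v' \<in> V" "\<forall>j\<in>{1..J}. w j \<in> {1..N}" "\<forall>j\<in>{1..J}. w' j \<in> {1..N}"
    and "position w v J = position w' v' J"
  shows "(v + 1) * turn w J = (v' + 1) * turn w' J"
  using assms(3-)
proof (induction J)
  case (Suc J)
  let ?i = "w (Suc J)" and ?j = "w' (Suc J)" and ?x = "position w v J" and ?y = "position w' v' J"
  have ij: "?i \<in> {1..N}" "?j \<in> {1..N}" and eq: "Psi L \<nu> ?i ?x = Psi L \<nu> ?j ?y"
    and w: "\<forall>j\<in>{1..J}. w j \<in> {1..N}" "\<forall>j\<in>{1..J}. w' j \<in> {1..N}" using Suc.prems by auto
  show ?case
  proof (cases "?i = ?j")
    case True
    then have "?x = ?y" using eq inj_Psi[OF L] by (auto dest: injD)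
    then show ?thesis using Suc.IH w True by (simp add: turn_Suc)
  next
    case False
    have "?x \<in> P" "?y \<in> P" using assms(1,2) w by (auto intro: position_in_hull)
    then have xy: "?x \<in> V" "?y \<in> V" using overlap_vertices[OF ij False eq] by auto
    have "(?x + 1) * a ?i = (?y + 1) * a ?j"
      using label_touch[OF ij False, of "?x + 1" "?y + 1"] xy eq by (simp add: in_V_iff)
    then have "(?x + 1) ^ (e ^ J) * a ?i ^ (e ^ J) = (?y + 1) ^ (e ^ J) * a ?j ^ (e ^ J)"
      by (metis power_mult_distrib)
    then show ?thesis
      using corner_label[OF assms(1) w(1) refl xy(1)] corner_label[OF assms(2) w(2) refl xy(2)]
      by (simp add: turn_Suc mult.assoc[symmetric])
  qed
qed simp

definition shift :: "(nat \<Rightarrow> nat) \<Rightarrow> nat \<Rightarrow> complex" where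
  "shift w J = (\<Sum>j=1..J. L ^ j *\<^sub>R \<nu> (w j))"

text \<open>Allows addresses of different lengths to be compared at a common length:
  \<open>i0\<close> has translation \<open>0\<close> and rotation \<open>1\<close>.\<close>

lemma pad_word:
  fixes w :: "nat \<Rightarrow> nat"
  assumes "J \<le> J'"
  defines "w' \<equiv> \<lambda>j. if j \<le> J then w j else i0"
  shows "shift w' J' = shift w J" "turn w' J' = turn w J"
  using assms(1)
proof (induction J' rule: dec_induct)
  case base
  show "shift w' J = shift w J" by (auto simp: shift_def w'_def intro!: sum.cong)
  show "turn w' J = turn w J" by (auto simp: turn_def w'_def intro!: prod.cong)
next
  case (step n)
  then show "shift w' (Suc n) = shift w J" "turn w' (Suc n) = turn w J"
    using i0 by (simp_all add: shift_def turn_Suc w'_def)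
qed

lemma label_unique:
  assumes "v \<in> V" "v' \<in> V" "\<forall>j\<in>{1..J}. w j \<in> {1..N}" "\<forall>j\<in>{1..J'}. w' j \<in> {1..N}"
    and eq: "v + shift w J = v' + shift w' J'"
  shows "(v + 1) * turn w J = (v' + 1) * turn w' J'"
proof -
  define n where "n = max J J'"
  define x y where "x = (\<lambda>j. if j \<le> J then w j else i0)" and "y = (\<lambda>j. if j \<le> J' then w' j else i0)"
  have x: "shift x n = shift w J" "turn x n = turn w J"
    and y: "shift y n = shift w' J'" "turn y n = turn w' J'"
    unfolding x_def y_def n_def by (simp_all add: pad_word)
  have "L ^ n *\<^sub>R position x v n = L ^ n *\<^sub>R position y v' n"
    using eq x y by (simp add: position_eq shift_def)
  then have "position x v n = position y v' n" using L by simp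
  moreover have "\<forall>j\<in>{1..n}. x j \<in> {1..N}" "\<forall>j\<in>{1..n}. y j \<in> {1..N}"
    using assms(3,4) i0(1) by (auto simp: x_def y_def)
  ultimately show ?thesis
    using label_well_defined[OF assms(1,2), of n x y] x y by simp
qed

lemma good_labelling: "good_labelling_property N L \<nu>"
proof -
  define rep where "rep z c \<longleftrightarrow> (\<exists>J w v. J \<ge> 1 \<and> (\<forall>j\<in>{1..J}. w j \<in> {1..N}) \<and> v \<in> V \<and>
    z = v + shift w J \<and> c = (v + 1) * turn w J)" for z c
  \<comment> \<open>A vertex may have many addresses; \<open>label_unique\<close> shows that they
    all give the same label.\<close>
  define lab where "lab z = (THE c. rep z c)" for z
  have lab: "lab (v + shift w J) = (v + 1) * turn w J"
    if "J \<ge> 1" "\<forall>j\<in>{1..J}. w j \<in> {1..N}" "v \<in> V" for J w v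
    unfolding lab_def
  proof (rule the_equality)
    show "rep (v + shift w J) ((v + 1) * turn w J)" using that unfolding rep_def by blast
    show "c = (v + 1) * turn w J" if "rep (v + shift w J) c" for c
      using that label_unique \<open>v \<in> V\<close> \<open>\<forall>j\<in>{1..J}. w j \<in> {1..N}\<close> unfolding rep_def by metis
  qed
  have lab_V: "lab v = v + 1" if "v \<in> V" for v
    \<comment> \<open>Addresses have length at least one, so the base complex is reached by the
      single letter \<open>i0\<close>.\<close>
    using lab[of 1 "\<lambda>_. i0" v] that i0 by (simp add: shift_def turn_def)
  \<comment> \<open>\<open>g\<close> translates roots of unity into the numerical labels of the
    definition.\<close>
  obtain g where g: "bij_betw g {u::complex. u ^ k = 1} {..<k}"
  proof -
    have "finite {u::complex. u ^ k = 1}" using k by (simp add: finite_roots_unity)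
    then show ?thesis
      using that ex_bij_betw_finite_nat[of "{u::complex. u ^ k = 1}"] k
      by (auto simp: card_roots_unity_eq atLeast0LessThan)
  qed
  have shifts: "\<exists>J w. J \<ge> 1 \<and> (\<forall>j\<in>{1..J}. w j \<in> {1..N}) \<and> s = shift w J"
    if "s \<in> complex_shifts N L \<nu>" for s
    using that unfolding complex_shifts_def shift_def by blast
  show ?thesis
    unfolding good_labelling_property_def essential card_V
  proof (intro exI[of _ "\<lambda>z. g (lab z)"] conjI ballI)
    show "(\<lambda>z. g (lab z)) ` unbounded_vertices N L \<nu> \<subseteq> {..<k}"
    proof clarify
      fix z assume "z \<in> unbounded_vertices N L \<nu>"
      then obtain s v where s: "s \<in> complex_shifts N L \<nu>" and v: "v \<in> V" "z = v + s"
        unfolding unbounded_vertices_def complex_vertices_def essential by blast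
      obtain J w where w: "J \<ge> 1" "\<forall>j\<in>{1..J}. w j \<in> {1..N}" "s = shift w J"
        using shifts[OF s] by blast
      have "lab z = (v + 1) * turn w J" using lab w v by simp
      then have "lab z ^ k = 1"
        using turn_root[OF w(2)] v by (simp add: power_mult_distrib in_V_iff)
      then show "g (lab z) < k" using g by (auto simp: bij_betw_def)
    qed
    have "bij_betw (\<lambda>v. v + 1) V {u. u ^ k = 1}"
      by (intro bij_betwI[where g = "\<lambda>u. u - 1"]) auto
    from bij_betw_trans[OF this g] show "bij_betw (\<lambda>z. g (lab z)) V {..<k}"
      by (rule iffD1[OF bij_betw_cong, rotated]) (simp add: lab_V del: image_iff)
  next
    fix s assume "s \<in> complex_shifts N L \<nu>"
    then obtain J w where w: "J \<ge> 1" "\<forall>j\<in>{1..J}. w j \<in> {1..N}" "s = shift w J"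
      using shifts by blast
    define t where "t = turn w J"
    have t: "t ^ k = 1" using turn_root w by (simp add: t_def)
    then have "norm t = 1" using k by (intro norm_root[of t k]) auto
    then have cis: "cis (Arg t) = t" by (metis norm_zero cis_Arg sgn_eq complex_sgn_def inverse_1 scaleR_one zero_neq_one)
    \<comment> \<open>Rotation about the barycenter by the turn of the complex, chosen so that
      \<open>R (v - s) + 1\<close> is the label of \<open>v\<close>.\<close>
    define R where "R z = -1 + t * (z - -1)" for z
    have RV: "R v \<in> V" if "v \<in> V" for v
      using that t by (simp add: in_V_iff R_def power_mult_distrib)
    have "R ` V = V"
    proof (rule endo_inj_surj)
      show "inj_on R V" using \<open>norm t = 1\<close> by (auto simp: inj_on_def R_def)
    qed (use RV finV in auto)
    then have "R \<in> vertex_rotations N L \<nu>"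
      unfolding vertex_rotations_def essential barycenter_eq using cis R_def by (auto intro!: exI[of _ "Arg t"])
    moreover have "g (lab v) = g (lab (R (v - s)))" if "v \<in> complex_vertices N L \<nu> s" for v
    proof -
      obtain u where u: "u \<in> V" "v = u + s"
        using \<open>v \<in> complex_vertices N L \<nu> s\<close> unfolding complex_vertices_def essential by blast
      show ?thesis
        using lab[OF w(1,2) u(1)] lab_V[OF RV[OF u(1)]] u w(3) by (simp add: R_def t_def mult.commute)
    qed
    ultimately show "\<exists>R\<in>vertex_rotations N L \<nu>. \<forall>v\<in>complex_vertices N L \<nu> s.
      g (lab v) = g (lab (R (v - s)))" by blast
  qed
qed

end

section \<open>Reflections and interior of the polygon of roots\<close>

lemma cnj_root: "u \<in> roots k \<Longrightarrow> k > 0 \<Longrightarrow> cnj u = inverse u"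
  using norm_root[of u k] complex_norm_square[of u] by (intro inverse_unique[symmetric]) auto

text \<open>Up to the translation by \<open>-1\<close>, the bisector of two points of the unit
  circle passes through the origin, so the reflection is conjugation followed by the unimodular
  factor \<open>u * v\<close> that swaps \<open>u\<close> and \<open>v\<close>.\<close>

lemma bisector_reflection_eq:
  assumes "norm u = 1" "norm v = 1" "u \<noteq> v"
  shows "bisector_reflection (u - 1) (v - 1) (z - 1) = u * v * cnj z - 1"
proof -
  define w where "w = v - u"
  have u: "u * cnj u = 1" and v: "v * cnj v = 1"
    using assms complex_norm_square[of u] complex_norm_square[of v] by auto
  have w: "w \<noteq> 0" "w = - u * v * cnj w"
    using assms(3) u v by (auto simp: w_def algebra_simps)
  have "midpoint u v \<bullet> w = 0"
    using assms by (simp add: midpoint_def w_def inner_add_left inner_add_right inner_diff_right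
        inner_diff_left inner_commute[of v u] dot_square_norm)
  then have inner: "(z - midpoint u v) \<bullet> w = z \<bullet> w" by (simp add: inner_diff_left)
  have "2 * (z \<bullet> w) = 2 * Re (z * cnj w)"
    by (simp add: inner_complex_def)
  then have zw: "of_real (2 * (z \<bullet> w)) = z * cnj w + cnj z * w"
    by (metis complex_add_cnj complex_cnj_cnj complex_cnj_mult)
  have "midpoint (u - 1) (v - 1) = midpoint u v - 1"
    by (simp add: midpoint_def algebra_simps scaleR_conv_of_real)
  then have "bisector_reflection (u - 1) (v - 1) (z - 1)
    = z - 1 - (2 * (z \<bullet> w) / (norm w)\<^sup>2) *\<^sub>R w"
    using inner by (simp add: bisector_reflection_def w_def)
  also have "(2 * (z \<bullet> w) / (norm w)\<^sup>2) *\<^sub>R w = (z * cnj w + cnj z * w) / (w * cnj w) * w"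
    using zw by (simp add: scaleR_conv_of_real complex_norm_square[symmetric] flip: of_real_power)
  also have "\<dots> = z + cnj z * (w / cnj w)"
    using w(1) by (simp add: field_simps)
  also have "w / cnj w = - u * v"
    using w by (metis complex_cnj_zero_iff nonzero_eq_divide_eq)
  finally show ?thesis by (simp add: algebra_simps)
qed

text \<open>The triangle on \<open>1\<close>, \<open>w\<close> and \<open>cnj w\<close> is already
  nondegenerate: after moving \<open>1\<close> to the origin, the other two vertices are linearly
  independent.\<close>

lemma interior_hull_roots:
  assumes "k \<ge> 3"
  shows "interior (convex hull ((\<lambda>u. u - 1) ` roots k)) \<noteq> {}"
proof -
  define t where "t = 2 * pi / real k"
  have t: "0 < t" "t < pi" using assms by (auto simp: t_def field_simps)
  have s: "sin t > 0" using t by (rule sin_gt_zero)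
  then have c: "cos t \<noteq> 1" using sin_cos_squared_add[of t] by (intro notI) simp
  define w where "w = cis t"
  have "w ^ k = cis (real k * t)" unfolding w_def by (rule Complex.DeMoivre)
  then have w: "w \<in> roots k" "cnj w \<in> roots k"
    using assms by (simp_all add: t_def flip: complex_cnj_power)
  have ne: "cnj w - 1 \<notin> span {w - 1}"
  proof
    assume "cnj w - 1 \<in> span {w - 1}"
    then obtain r where r: "cnj w - 1 = r *\<^sub>R (w - 1)" by (auto simp: span_singleton)
    then have "cos t - 1 = r * (cos t - 1)" "- sin t = r * sin t"
      by (simp_all add: complex_eq_iff w_def)
    then show False using s c by auto
  qed
  have "w \<noteq> 1" using c by (auto simp: w_def complex_eq_iff)
  moreover have "cnj w - 1 \<noteq> w - 1" using ne span_base[of "w - 1" "{w - 1}"] by auto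
  moreover have "independent {cnj w - 1, w - 1}"
    using ne \<open>w \<noteq> 1\<close> by (subst independent_insert) auto
  ultimately obtain x where x: "x \<in> interior (convex hull (insert 0 {cnj w - 1, w - 1}))"
    using interior_simplex_nonempty[of "{cnj w - 1, w - 1}"] by auto
  have "insert 0 {cnj w - 1, w - 1} \<subseteq> (\<lambda>u. u - 1) ` roots k"
    using w by (auto simp: image_iff intro: exI[of _ 1])
  then show ?thesis using x interior_mono[OF hull_mono] by blast
qed

section \<open>Fractals from configurations of cell centers\<close>

text \<open>
  \<open>S\<close> consists of the centers of the cells, multiplied by \<open>L = 1 + l\<close>, when the barycenter is at the
  origin; touching cells satisfy \<open>s + u = t + v\<close> for the common vertex.
\<close>

locale root_system =
  fixes k :: nat and l d :: real and S :: "complex set" and A :: "complex \<Rightarrow> complex" and e :: nat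
  assumes k: "k \<ge> 3" and l: "l > 0" and dpos: "d > 0" and finS: "finite S"
    and corner: "\<And>u. u \<in> roots k \<Longrightarrow> l *\<^sub>R u \<in> S"
    and inside: "\<And>s. s \<in> S \<Longrightarrow> \<exists>p\<in>convex hull roots k. s = l *\<^sub>R p"
    and separated: "\<And>s t. s \<in> S \<Longrightarrow> t \<in> S \<Longrightarrow> s \<noteq> t \<Longrightarrow> d \<le> dist s t"
    and diam: "\<And>u v. u \<in> roots k \<Longrightarrow> v \<in> roots k \<Longrightarrow> dist u v \<le> d"
    and symm: "\<And>s u. s \<in> S \<Longrightarrow> u \<in> roots k \<Longrightarrow> u * cnj s \<in> S"
    and connected: "\<And>s t. s \<in> S \<Longrightarrow> t \<in> S \<Longrightarrow> (s, t) \<in> {(s, t). s \<in> S \<and> t \<in> S \<and>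
      (\<exists>u\<in>roots k. \<exists>v\<in>roots k. s + u = t + v)}\<^sup>*"
    and label_root: "\<And>s. s \<in> S \<Longrightarrow> A s ^ k = 1"
    and label_touch: "\<And>s t u v. \<lbrakk>s \<in> S; t \<in> S; s \<noteq> t; u \<in> roots k; v \<in> roots k;
      s + u = t + v\<rbrakk> \<Longrightarrow> u * A s = v * A t"
    and label_corner: "\<And>u. u \<in> roots k \<Longrightarrow> u * A (l *\<^sub>R u) = u ^ e"
begin

text \<open>A path between two distinct corner cells must leave its starting cell; the first step
  that is not a loop gives the pair.\<close>

lemma touching_pair:
  obtains s t u v where "s \<in> S" "t \<in> S" "s \<noteq> t" "u \<in> roots k" "v \<in> roots k" "s + u = t + v"
proof -
  define s where "s = l *\<^sub>R (1::complex)"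
  have s: "s \<in> S" unfolding s_def by (rule corner) simp
  obtain w where w: "w \<in> roots k" "w \<noteq> 1"
  proof -
    have "\<not> roots k \<subseteq> {1}"
      using k card_mono[of "{1}" "roots k"] by (auto simp: card_roots_unity_eq)
    then show ?thesis using that by blast
  qed
  define t where "t = l *\<^sub>R w"
  have "t \<in> S" "s \<noteq> t" unfolding s_def t_def using corner w l by auto
  from connected[OF s \<open>t \<in> S\<close>] \<open>s \<noteq> t\<close>
  have "\<exists>t' u v. s \<noteq> t' \<and> t' \<in> S \<and> u \<in> roots k \<and> v \<in> roots k \<and> s + u = t' + v"
  proof (induction rule: converse_rtrancl_induct)
    case base
    then show ?case by simp
  next
    case (step y z)
    then show ?case by (cases "y = z") auto
  qed
  then show ?thesis using that s by blast
qed

lemma realization: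
  "\<exists>(N :: nat) L \<nu>. simple_nested_fractal N L \<nu> \<and> card (essential_fixed_points N L \<nu>) = k \<and>
     good_labelling_property N L \<nu>"
proof -
  define L where "L = 1 + l"
  have L: "L > 1" using l by (simp add: L_def)
  define N where "N = card S"
  obtain f where f: "bij_betw f {1..N} S"
    unfolding N_def using ex_bij_betw_nat_finite_1[OF finS] by blast
  have fS: "f i \<in> S" if "i \<in> {1..N}" for i using bij_betwE[OF f] that by blast
  have finj: "f i = f j \<longleftrightarrow> i = j" if "i \<in> {1..N}" "j \<in> {1..N}" for i j
    using inj_on_eq_iff[OF bij_betw_imp_inj_on[OF f]] that by blast
  have fsurj: "\<exists>i\<in>{1..N}. f i = s" if "s \<in> S" for s using bij_betw_imp_surj_on[OF f] that by blast
  \<comment> \<open>The origin is moved to the vertex \<open>1\<close>, the fixed point of the map that must be \<open>x / L\<close>.\<close>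
  define \<nu> where "\<nu> i = (f i - of_real l) /\<^sub>R L" for i
  define V where "V = (\<lambda>u. u - 1) ` roots k"
  have Psi: "Psi L \<nu> i (z - 1) = (f i + z) /\<^sub>R L - 1" for i z
  proof -
    have "z - 1 + (f i - of_real l) = f i + z - of_real L" by (simp add: L_def)
    then have "Psi L \<nu> i (z - 1) = (f i + z - of_real L) /\<^sub>R L"
      by (simp add: Psi_def \<nu>_def flip: scaleR_add_right)
    also have "\<dots> = (f i + z) /\<^sub>R L - 1"
      using L by (simp add: scaleR_diff_right) (simp add: scaleR_conv_of_real)
    finally show ?thesis .
  qed
  have hull: "p - 1 \<in> convex hull V" if "p \<in> convex hull roots k" for p
    using that convex_hull_translation[of "-1" "roots k"] by (auto simp: V_def)
  have Psi_corner: "Psi L \<nu> i (p - 1) = p - 1" if "f i = l *\<^sub>R p" for i p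
  proof -
    have "f i + p = L *\<^sub>R p" using that by (simp add: L_def algebra_simps)
    then show ?thesis using L by (simp add: Psi)
  qed
  have kpos: "k > 0" using k by simp
  have finR: "finite (roots k)" using kpos by (simp add: finite_roots_unity)
  obtain i0 where i0: "i0 \<in> {1..N}" "f i0 = of_real l"
    using fsurj[OF corner[of 1]] by (auto simp: scaleR_conv_of_real)
  interpret labelled_system N L \<nu> k d "\<lambda>i. A (f i)" e i0
  proof (unfold_locales, fold V_def)
    show "L > 1" by (rule L)
    show "d > 0" by (rule dpos)
    show "k \<ge> 3" by (rule k)
    show "i0 \<in> {1..N}" by (rule i0)
    show "finite V" using finR by (simp add: V_def)
    show "V \<noteq> {}" using power_one[of k] unfolding V_def by blast
    \<comment> \<open>All vertices lie on the unit circle around \<open>-1\<close>, hence are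
      extreme already in the disc.\<close>
    show "v extreme_point_of convex hull V" if "v \<in> V" for v
    proof -
      have *: "dist (-1) x = 1" if "x \<in> V" for x
        using that norm_root[OF _ kpos] by (auto simp: V_def dist_norm norm_minus_commute)
      then have "convex hull V \<subseteq> cball (-1) 1" by (intro hull_minimal) auto
      then show ?thesis
        using extreme_point_of_cball[OF *[OF that]] hull_inc[of v V convex] that
        by (auto simp: extreme_point_of_def)
    qed
    show "dist u v \<le> d" if "u \<in> V" "v \<in> V" for u v
      using that diam by (auto simp: V_def dist_norm)
    show "d \<le> L * dist (\<nu> i) (\<nu> j)" if "i \<in> {1..N}" "j \<in> {1..N}" "i \<noteq> j" for i j

    proof -
      have "\<nu> i - \<nu> j = (f i - f j) /\<^sub>R L"
        by (simp add: \<nu>_def flip: scaleR_diff_right)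
      then have "L * dist (\<nu> i) (\<nu> j) = dist (f i) (f j)" using L by (simp add: dist_norm)
      then show ?thesis using separated[OF fS fS, of i j] that finj by auto
    qed
    show "\<exists>i\<in>{1..N}. Psi L \<nu> i v = v" if "v \<in> V" for v
    proof -
      obtain u where u: "u \<in> roots k" "v = u - 1" using \<open>v \<in> V\<close> unfolding V_def by blast
      obtain i where "i \<in> {1..N}" "f i = l *\<^sub>R u" using fsurj[OF corner[OF u(1)]] by blast
      then show ?thesis using Psi_corner u(2) by blast
    qed
    show "\<exists>p\<in>convex hull V. Psi L \<nu> i p = p" if "i \<in> {1..N}" for i
      using inside[OF fS[OF that]] hull Psi_corner by blast
    show "\<exists>w\<in>V. \<exists>i\<in>{1..N}. \<exists>j\<in>{1..N}. i \<noteq> j \<and> Psi L \<nu> i v = Psi L \<nu> j w" if "v \<in> V" for v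
    proof -
      obtain x where x: "x \<in> roots k" "v = x - 1" using \<open>v \<in> V\<close> by (auto simp: V_def)
      obtain s t u y where *: "s \<in> S" "t \<in> S" "s \<noteq> t" "u \<in> roots k" "y \<in> roots k"
        "s + u = t + y" by (rule touching_pair)
      \<comment> \<open>Rotating one touching pair by \<open>r\<close> moves its contact vertex from
        \<open>u\<close> to \<open>x\<close>. The set \<open>S\<close> admits this rotation as a
        product of two of the reflections in \<open>symm\<close>.\<close>
      define r where "r = x * cnj u"
      have r: "r \<in> roots k" using x *(4) by (simp add: r_def power_mult_distrib flip: complex_cnj_power)
      have "r * s \<in> S" if "s \<in> S" for s
        using symm[OF symm[OF that, of 1] r] by simp
      then obtain i j where ij: "i \<in> {1..N}" "j \<in> {1..N}" "f i = r * s" "f j = r * t"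
        using fsurj *(1,2) by metis
      have "u \<noteq> 0" "r \<noteq> 0" using *(4) r kpos by (auto simp: power_0_left)
      have "r * u = x" using cnj_root[OF *(4) kpos] \<open>u \<noteq> 0\<close> by (simp add: r_def)
      have "f i + x = r * (s + u)"
        using ij \<open>r * u = x\<close> by (simp add: algebra_simps)
      also have "\<dots> = f j + r * y" using ij *(6) by (simp add: algebra_simps)
      finally have "Psi L \<nu> i v = Psi L \<nu> j (r * y - 1)" by (simp add: x Psi)
      moreover have "r * y - 1 \<in> V" using r *(5) by (auto simp: V_def power_mult_distrib)
      moreover have "i \<noteq> j" using ij *(3) \<open>r \<noteq> 0\<close> by auto
      ultimately show ?thesis using ij by blast
    qed
    show "\<nu> i0 = 0" using i0 by (simp add: \<nu>_def)
    show "A (f i0) = 1" using label_corner[of 1] i0 by (simp add: scaleR_conv_of_real)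
    show "A (f i) ^ k = 1" if "i \<in> {1..N}" for i using label_root fS that by blast
    show "u * A (f i) = v * A (f j)"
      if "i \<in> {1..N}" "j \<in> {1..N}" "i \<noteq> j" "u ^ k = 1" "v ^ k = 1" "Psi L \<nu> i (u - 1) = Psi L \<nu> j (v - 1)"
      for i j u v
      using that by (intro label_touch) (use L in \<open>auto simp: fS finj Psi\<close>)
    show "u * A (f i) = u ^ e" if "i \<in> {1..N}" "u ^ k = 1" "Psi L \<nu> i (u - 1) = u - 1" for i u
    proof -
      have "(f i + u) /\<^sub>R L = u" using that(3) by (simp add: Psi)
      then have "f i + u = L *\<^sub>R u" using L by (metis divideR_right less_numeral_extra(3) less_trans zero_less_one)
      then have "f i = l *\<^sub>R u" by (simp add: L_def algebra_simps)
      then show ?thesis using label_corner[of u] that(2) by simp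
    qed
  qed
  note essential = essential[folded V_def]
  have "symmetry N L \<nu>"
    unfolding symmetry_def essential
  proof (intro ballI impI)
    fix i x y assume i: "i \<in> {1..N}" and xy: "x \<in> V" "y \<in> V" "x \<noteq> y"
    then obtain u v where uv: "u \<in> roots k" "v \<in> roots k" "x = u - 1" "y = v - 1" by (auto simp: V_def)
    define r where "r = u * v"
    have r: "r \<in> roots k" using uv by (simp add: r_def power_mult_distrib)
    have refl: "bisector_reflection x y (z - 1) = r * cnj z - 1" for z
      unfolding uv r_def using uv xy kpos by (intro bisector_reflection_eq) (auto simp: norm_root)
    obtain j where j: "j \<in> {1..N}" "f j = r * cnj (f i)"
      using fsurj[OF symm[OF fS[OF i] r]] by blast
    have R: "(\<lambda>z. r * cnj z) ` roots k = roots k"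
    proof (rule endo_inj_surj[OF finR])
      show "(\<lambda>z. r * cnj z) ` roots k \<subseteq> roots k"
        using r by (auto simp: power_mult_distrib simp flip: complex_cnj_power)
      show "inj_on (\<lambda>z. r * cnj z) (roots k)"
        using r kpos by (auto simp: inj_on_def power_0_left)
    qed
    have "bisector_reflection x y ` Psi L \<nu> i ` V = (\<lambda>z. (f j + z) /\<^sub>R L - 1) ` (\<lambda>z. r * cnj z) ` roots k"
      unfolding V_def image_image Psi refl j by (simp add: algebra_simps)
    also have "\<dots> = Psi L \<nu> j ` V" unfolding R V_def image_image Psi ..
    finally show "\<exists>j\<in>{1..N}. bisector_reflection x y ` Psi L \<nu> i ` V = Psi L \<nu> j ` V" using j by blast
  qed
  moreover have "connectivity N L \<nu>"
  proof (rule connectivity, fold V_def)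
    fix i j assume ij: "i \<in> {1..N}" "j \<in> {1..N}"
    let ?E = "{(i, j). i \<in> {1..N} \<and> j \<in> {1..N} \<and> Psi L \<nu> i ` V \<inter> Psi L \<nu> j ` V \<noteq> {}}"
    have *: "(i, j) \<in> ?E\<^sup>*" if "f j = t" "j \<in> {1..N}" "(f i, t) \<in> {(s, t). s \<in> S \<and> t \<in> S \<and>
      (\<exists>u\<in>roots k. \<exists>v\<in>roots k. s + u = t + v)}\<^sup>*" for t j
      using that(3,1,2)
    proof (induction arbitrary: j rule: rtrancl_induct)
      case base
      then show ?case using finj ij by simp
    next
      case (step y z)
      then obtain m where m: "f m = y" "m \<in> {1..N}" using fsurj by blast
      obtain u v where uv: "u \<in> roots k" "v \<in> roots k" "f m + u = f j + v"
        using step.hyps(2) step.prems(1) m(1) by auto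
      then have "Psi L \<nu> m (u - 1) = Psi L \<nu> j (v - 1)" by (simp add: Psi)
      then have "(m, j) \<in> ?E" using m step.prems uv(1,2) unfolding V_def by blast
      then show ?case using step.IH[OF m] by (rule rtrancl_into_rtrancl[rotated])
    qed
    show "(i, j) \<in> ?E\<^sup>*" by (rule *[OF refl ij(2) connected[OF fS fS]]) (fact ij)+
  qed
  moreover have "open_set_condition N L \<nu>"
    using interior_hull_roots[OF k] by (rule open_set_condition)
  ultimately have "simple_nested_fractal N L \<nu>"
    unfolding simple_nested_fractal_def using L i0 nesting essential card_V k
    by (auto simp: \<nu>_def V_def)
  then show ?thesis
    using good_labelling card_V[folded V_def] essential by metis
qed

end

subsection \<open>Chords of regular polygons\<close>

text \<open>Replacing the exponent \<open>j\<close> by \<open>m - j\<close> if necessary keeps the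
  cosine and brings the angle between \<open>2 * pi / m\<close> and \<open>pi\<close>, where the
  cosine decreases.\<close>

lemma Re_root_le:
  assumes "u \<in> roots m" "u \<noteq> 1" "m > 0"
  shows "Re u \<le> cos (2 * pi / m)"
proof -
  obtain j where j: "j < m" "u = cis (2 * pi * j / m)"
    using bij_betw_imp_surj_on[OF Complex.bij_betw_roots_unity[OF assms(3)]] assms(1) by blast
  then have "j > 0" using assms(2) by (cases j) auto
  have le: "cos (2 * pi * i / m) \<le> cos (2 * pi / m)" if "i > 0" "2 * i \<le> m" for i :: nat
  proof (rule cos_monotone_0_pi_le)
    have "2 * real i \<le> real m" using that by (simp flip: of_nat_mult)
    then have "pi * (2 * real i) \<le> pi * real m" by (rule mult_left_mono) simp
    then show "2 * pi * real i / real m \<le> pi" using assms(3) by (simp add: field_simps)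
    show "2 * pi / real m \<le> 2 * pi * real i / real m"
      using that assms(3) by (simp add: divide_right_mono)
  qed simp
  show ?thesis
  proof (cases "2 * j \<le> m")
    case True
    then show ?thesis using le[of j] \<open>j > 0\<close> j by simp
  next
    case False
    have "2 * pi * (m - j) / m = 2 * pi - 2 * pi * j / m"
      using j assms(3) by (simp add: of_nat_diff field_simps)
    then have "cos (2 * pi * j / m) = cos (2 * pi * (m - j) / m)" by simp
    then show ?thesis using le[of "m - j"] False j by simp
  qed
qed

lemma dist_root_squared:
  assumes "norm u = 1" "norm v = 1"
  shows "(dist u v)\<^sup>2 = 2 - 2 * Re (u * cnj v)"
proof -
  have "(Re u)\<^sup>2 + (Im u)\<^sup>2 = 1" "(Re v)\<^sup>2 + (Im v)\<^sup>2 = 1"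
    using assms by (simp_all flip: cmod_power2)
  then show ?thesis
    unfolding dist_norm cmod_power2 by (simp add: power2_eq_square algebra_simps)
qed

lemma root_quotient:
  assumes "u \<in> roots k" "v \<in> roots k" "k > 0"
  shows "u * cnj v \<in> roots k" "u * cnj v = 1 \<longleftrightarrow> u = v" "u = u * cnj v * v"
proof -
  have v: "cnj v * v = 1" using norm_root[OF assms(2,3)] complex_norm_square[of v] by (simp add: mult.commute)
  show "u * cnj v \<in> roots k"
    using assms by (simp add: power_mult_distrib flip: complex_cnj_power)
  show *: "u = u * cnj v * v" using v by (simp add: mult.assoc)
  show "u * cnj v = 1 \<longleftrightarrow> u = v" using * v by (metis mult.commute mult_1)
qed

lemma two_sin_squared: "(2 * sin x)\<^sup>2 = 2 - 2 * cos (2 * x)" for x :: real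
  by (simp add: cos_double_sin power_mult_distrib)

text \<open>The bound is the side length of the regular polygon; the quotient of the two roots
  reduces it to \<open>Re_root_le\<close>.\<close>

lemma dist_roots_ge:
  assumes "u \<in> roots k" "v \<in> roots k" "u \<noteq> v" "k > 0"
  shows "2 * sin (pi / k) \<le> dist u v"
proof (rule power2_le_imp_le)
  have "Re (u * cnj v) \<le> cos (2 * pi / k)"
    using root_quotient[OF assms(1,2,4)] assms by (intro Re_root_le) auto
  then show "(2 * sin (pi / k))\<^sup>2 \<le> (dist u v)\<^sup>2"
    unfolding two_sin_squared using assms by (subst dist_root_squared) (auto simp: norm_root)
qed simp

text \<open>Equality in \<open>dist_roots_ge\<close> fixes the real part of the quotient
  \<open>w\<close>, and norm one then leaves only two conjugate values.\<close>

lemma neighbours_if_close: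
  assumes "u \<in> roots k" "v \<in> roots k" "u \<noteq> v" "k > 0" "dist u v \<le> 2 * sin (pi / k)"
  shows "u = v * cis (2 * pi / k) \<or> v = u * cis (2 * pi / k)"
proof -
  define w where "w = u * cnj v"
  have w: "norm w = 1" using assms by (simp add: w_def norm_mult norm_root)
  have "dist u v = 2 * sin (pi / k)"
    using dist_roots_ge[OF assms(1-4)] assms(5) by simp
  then have re: "Re w = cos (2 * pi / k)"
    using dist_root_squared[of u v] two_sin_squared[of "pi / k"] assms by (simp add: norm_root w_def)
  have "(cos (2 * pi / k))\<^sup>2 + (Im w)\<^sup>2 = 1"
    using w re cmod_power2[of w] by simp
  then have "(Im w)\<^sup>2 = (sin (2 * pi / k))\<^sup>2"
    using sin_cos_squared_add[of "2 * pi / k"] by linarith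
  with re have "w = cis (2 * pi / k) \<or> cnj w = cis (2 * pi / k)"
    by (auto simp: complex_eq_iff power2_eq_iff)
  moreover have "u = w * v" "v = cnj w * u"
    using root_quotient(3)[OF assms(1,2,4)] root_quotient(3)[OF assms(2,1,4)]
    by (simp_all add: w_def mult.commute)
  ultimately show ?thesis by (metis mult.commute)
qed

lemma zero_in_hull_roots: "k \<ge> 2 \<Longrightarrow> 0 \<in> convex hull roots k"
proof -
  assume k: "k \<ge> 2"
  have "(\<Sum>u\<in>roots k. (1 / real k) *\<^sub>R u) \<in> convex hull roots k"
    using k by (intro convex_sum) (auto simp: finite_roots_unity card_roots_unity_eq hull_inc)
  then show ?thesis using k by (simp add: sum_roots_unity flip: scaleR_right.sum)
qed

lemma extreme_point_hull_roots:
  assumes "u \<in> roots k" "k > 0" shows "u extreme_point_of convex hull roots k"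
proof -
  have "convex hull roots k \<subseteq> cball 0 1"
    using assms(2) by (intro hull_minimal) (auto simp: norm_root)
  then show ?thesis
    using extreme_point_of_cball[of 0 u 1] norm_root[OF assms] hull_inc[OF assms(1), of convex]
    by (auto simp: extreme_point_of_def)
qed

text \<open>The midpoints of two parallel diametral chords would again form a diametral pair.\<close>

lemma parallel_diameters_eq:
  assumes "\<And>u v. u \<in> roots k \<Longrightarrow> v \<in> roots k \<Longrightarrow> dist u v \<le> d"
    and "{x, y, x', y'} \<subseteq> roots k" "k > 0" "x - y = x' - y'" "d \<le> dist x y"
  shows "x = x'"
proof (rule ccontr)
  assume "x \<noteq> x'"
  let ?m = "midpoint x x'" and ?n = "midpoint y y'"
  have "?m - ?n = midpoint (x - y) (x' - y')"
    by (simp add: midpoint_def algebra_simps)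
  then have "d \<le> dist ?m ?n" using assms(4,5) by (simp add: dist_norm)
  moreover have "?m \<in> convex hull roots k" "?n \<in> convex hull roots k"
    using assms(2) by (auto intro!: midpoints_in_convex_hull intro: hull_inc simp del: mem_Collect_eq)
  ultimately have "?m \<in> roots k"
    using diametral_in_convex_hull[OF assms(1)] by blast
  then have "?m extreme_point_of convex hull roots k" using assms(3) by (rule extreme_point_hull_roots)
  moreover have "?m \<in> open_segment x x'" using \<open>x \<noteq> x'\<close> by simp
  moreover have "x \<in> convex hull roots k" "x' \<in> convex hull roots k"
    using assms(2) by (auto intro: hull_inc simp del: mem_Collect_eq)
  ultimately show False unfolding extreme_point_of_def by blast
qed

lemma rtrancl_hub:
  assumes "sym E" "\<And>s. s \<in> S \<Longrightarrow> (h, s) \<in> E\<^sup>*" "s \<in> S" "t \<in> S"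
  shows "(s, t) \<in> E\<^sup>*"
  using assms by (meson rtrancl_trans sym_rtrancl symD)

lemma roots_cyclic_connected:
  assumes "k > 0" "u \<in> roots k" and step: "\<And>u. u \<in> roots k \<Longrightarrow> (g u, g (u * cis (2 * pi / k))) \<in> E\<^sup>*"
  shows "(g 1, g u) \<in> E\<^sup>*"
proof -
  obtain j where j: "u = cis (2 * pi * real j / real k)"
    using bij_betw_imp_surj_on[OF Complex.bij_betw_roots_unity[OF assms(1)]] assms(2) by blast
  have "(g 1, g (cis (2 * pi * real i / real k))) \<in> E\<^sup>*" for i :: nat
  proof (induction i)
    case (Suc i)
    have "cis (2 * pi * real i / real k) ^ k = 1"
      using assms(1) by (simp add: Complex.DeMoivre)
    moreover have "cis (2 * pi * real (Suc i) / real k) = cis (2 * pi * real i / real k) * cis (2 * pi / k)"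
      by (simp add: cis_mult algebra_simps add_divide_distrib)
    ultimately show ?case
      using rtrancl_trans[OF Suc step[of "cis (2 * pi * real i / real k)"]] by simp
  qed simp
  then show ?thesis using j by simp
qed

text \<open>For even \<open>k\<close> take half of \<open>k\<close>, which is odd since
  \<open>4\<close> does not divide \<open>k\<close>. For odd \<open>k\<close> both neighbours of
  \<open>k / 2\<close> span longest chords, and one of them is odd.\<close>

lemma obtain_odd_diameter:
  assumes "k \<ge> 3" "\<not> 4 dvd k"
  obtains h where "odd h" "h < k" "\<And>u. u \<in> roots k \<Longrightarrow> cos (2 * pi * real h / real k) \<le> Re u"
proof (cases "even k")
  case True
  then obtain h where h: "k = 2 * h" by blast
  moreover have "odd h" using h assms(2) by auto
  moreover have "-1 \<le> Re u" if "u \<in> roots k" for u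
    using abs_Re_le_cmod[of u] norm_root[OF that] assms(1) by simp
  ultimately show ?thesis using that[of h] assms(1) by (simp add: mult.commute)
next
  case False
  then obtain h where h: "odd h" "k = 2 * h + 1 \<or> k + 1 = 2 * h"
  proof -
    obtain n where n: "k = 2 * n + 1" using False by (elim oddE)
    show ?thesis using that[of n] that[of "n + 1"] n by (cases "odd n") auto
  qed
  have "2 * pi * real h / real k = pi - pi / k \<or> 2 * pi * real h / real k = pi + pi / k"
  proof -
    have "2 * real h = real k - 1 \<or> 2 * real h = real k + 1" using h(2) by linarith
    then have "pi * (2 * real h) = pi * (real k - 1) \<or> pi * (2 * real h) = pi * (real k + 1)" by auto
    then show ?thesis using assms(1) by (auto simp: field_simps)
  qed
  then have "cos (2 * pi * real h / real k) = - cos (pi / k)" by (auto simp: cos_diff cos_add)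
  moreover have "- cos (pi / k) \<le> Re u" if "u \<in> roots k" for u
  proof -
    \<comment> \<open>For odd \<open>k\<close>, \<open>- u\<close> is a root of order dividing
      \<open>2 * k\<close> other than \<open>1\<close>, so \<open>Re_root_le\<close> applies to the
      finer polygon.\<close>
    have "(- u) ^ k = - 1" using that False by simp
    then have "- u \<in> roots (2 * k)" "- u \<noteq> 1" by (auto simp: power_mult power2_eq_square mult.commute[of 2])
    then have "Re (- u) \<le> cos (2 * pi / (2 * k))" using assms(1) by (intro Re_root_le) (auto simp del: uminus_complex.sel)
    then show ?thesis by simp
  qed
  ultimately show ?thesis using that[of h] h assms(1) by fastforce
qed

subsection \<open>The two families of fractals\<close>

text \<open>Both differences are multiples of \<open>\<i> * cis x\<close>, by
  \<open>2 * sin y\<close> and \<open>2 * sin x\<close>: parallel chords, compared by their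
  lengths.\<close>

lemma cis_chord_identity:
  "sin x *\<^sub>R (cis (y + x) - cis (x - y)) = sin y *\<^sub>R (cis (2 * x) - 1)"
proof -
  have "cos (y + x) - cos (x - y) = - 2 * sin x * sin y" "sin (y + x) - sin (x - y) = 2 * sin y * cos x"
    by (simp_all add: cos_add cos_diff sin_add sin_diff)
  moreover have "cos (2 * x) - 1 = - 2 * sin x * sin x"
    by (simp add: cos_double_sin power2_eq_square)
  ultimately show ?thesis by (simp add: complex_eq_iff sin_double)
qed

lemma realization_not_4_dvd:
  assumes k: "k \<ge> 3" and "\<not> 4 dvd k"
  shows "\<exists>(N :: nat) L \<nu>. simple_nested_fractal N L \<nu> \<and> card (essential_fixed_points N L \<nu>) = k \<and>
     good_labelling_property N L \<nu>"
proof -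
  obtain h where h: "odd h" "h < k" "\<And>u. u \<in> roots k \<Longrightarrow> cos (2 * pi * real h / real k) \<le> Re u"
    using obtain_odd_diameter[OF assms] by blast
  obtain m where m: "h = 2 * m + 1" using h(1) by (elim oddE)
  define \<alpha> where "\<alpha> = pi / k"
  \<comment> \<open>The ratio of diameter to side, so that neighbouring corner centers are exactly
    \<open>d\<close> apart.\<close>
  define l where "l = sin (h * \<alpha>) / sin \<alpha>"
  define d where "d = 2 * sin (h * \<alpha>)"
  define \<omega> where "\<omega> = cis (2 * pi / k)"
  have kpos: "k > 0" using k by simp
  have finR: "finite (roots k)" using kpos by (simp add: finite_roots_unity)
  have sin: "sin \<alpha> > 0" "sin (h * \<alpha>) > 0"
  proof -
    have "0 < \<alpha>" "\<alpha> < pi" using k by (auto simp: \<alpha>_def field_simps)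
    moreover have "h * \<alpha> < k * \<alpha>" using h(2) \<open>0 < \<alpha>\<close> by simp
    moreover have "k * \<alpha> = pi" "h > 0" using k m by (simp_all add: \<alpha>_def)
    ultimately show "sin \<alpha> > 0" "sin (h * \<alpha>) > 0" by (simp_all add: sin_gt_zero)
  qed
  have l: "l > 0" "l * (2 * sin \<alpha>) = d" using sin by (simp_all add: l_def d_def)
  have \<omega>: "\<omega> \<in> roots k" "\<omega> * cnj \<omega> = 1" "\<omega> = cis (2 * \<alpha>)"
    using kpos by (simp_all add: \<omega>_def \<alpha>_def Complex.DeMoivre cis_mult cis_cnj)
  define S where "S = (\<lambda>u. l *\<^sub>R u) ` roots k"
  \<comment> \<open>On the center of the corner cell at \<open>u\<close> this is
    \<open>u ^ h\<close>.\<close>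
  define A where "A s = (s /\<^sub>R l) ^ h" for s :: complex
  have A: "A (l *\<^sub>R u) = u ^ h" for u using l by (simp add: A_def)
  have diam: "dist u v \<le> d" if "u \<in> roots k" "v \<in> roots k" for u v
  proof (rule power2_le_imp_le)
    have "2 * pi * real h / real k = 2 * (h * \<alpha>)" by (simp add: \<alpha>_def)
    then have "cos (2 * (h * \<alpha>)) \<le> Re (u * cnj v)"
      using h(3)[OF root_quotient(1)[OF that kpos]] by metis
    then show "(dist u v)\<^sup>2 \<le> d\<^sup>2"
      unfolding d_def two_sin_squared using that kpos by (subst dist_root_squared) (auto simp: norm_root)
    show "0 \<le> d" using sin by (simp add: d_def)
  qed
  have dist_scaled: "dist (l *\<^sub>R u) (l *\<^sub>R v) = l * dist u v" for u v :: complex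
    using l(1) by (simp add: dist_norm flip: scaleR_diff_right)
  have far: "d \<le> dist (l *\<^sub>R u) (l *\<^sub>R v)" if "u \<in> roots k" "v \<in> roots k" "u \<noteq> v" for u v
  proof -
    have "l * (2 * sin \<alpha>) \<le> l * dist u v"
      using dist_roots_ge[OF that kpos] l(1) unfolding \<alpha>_def by (intro mult_left_mono) auto
    then show ?thesis unfolding l(2) dist_scaled .
  qed
  \<comment> \<open>The exponents \<open>m + 1\<close> and \<open>-m\<close> differ by
    \<open>h\<close> and have the same mean as \<open>1\<close> and \<open>0\<close>, so this
    diametral chord is parallel to the side from \<open>1\<close> to \<open>\<omega>\<close>.
    Oddness of \<open>h\<close> makes both exponents integers.\<close>
  have chord: "l *\<^sub>R 1 + \<omega> ^ (m + 1) = l *\<^sub>R \<omega> + cnj \<omega> ^ m"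
  proof -
    have "\<omega> ^ (m + 1) = cis (h * \<alpha> + \<alpha>)" "cnj \<omega> ^ m = cis (\<alpha> - h * \<alpha>)"
      unfolding \<omega>(3) cis_cnj Complex.DeMoivre by (simp_all add: m algebra_simps)
    then have "sin \<alpha> *\<^sub>R (\<omega> ^ (m + 1) - cnj \<omega> ^ m) = sin (h * \<alpha>) *\<^sub>R (\<omega> - 1)"
      using \<omega>(3) cis_chord_identity[of \<alpha> "h * \<alpha>"] by simp
    then have "\<omega> ^ (m + 1) - cnj \<omega> ^ m = (sin (h * \<alpha>) *\<^sub>R (\<omega> - 1)) /\<^sub>R sin \<alpha>"
      using sin(1) by (metis divideR_right less_irrefl)
    then have "\<omega> ^ (m + 1) - cnj \<omega> ^ m = l *\<^sub>R (\<omega> - 1)"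
      by (simp add: l_def divide_inverse mult.commute)
    then show ?thesis by (simp add: algebra_simps)
  qed
  have step: "u * \<omega> \<in> roots k" "u * \<omega> ^ (m + 1) \<in> roots k" "u * cnj \<omega> ^ m \<in> roots k"
    "l *\<^sub>R u + u * \<omega> ^ (m + 1) = l *\<^sub>R (u * \<omega>) + u * cnj \<omega> ^ m" if "u \<in> roots k" for u
  proof -
    have "(\<omega> ^ k) ^ (m + 1) = 1" "(cnj (\<omega> ^ k)) ^ m = 1" using \<omega> by auto
    then show "u * \<omega> \<in> roots k" "u * \<omega> ^ (m + 1) \<in> roots k" "u * cnj \<omega> ^ m \<in> roots k"
      using that \<omega>(1) by (simp_all add: power_mult_distrib mult.commute flip: power_mult)
    have "l *\<^sub>R u + u * \<omega> ^ (m + 1) = u * (l *\<^sub>R 1 + \<omega> ^ (m + 1))" by (simp add: algebra_simps)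
    also have "\<dots> = l *\<^sub>R (u * \<omega>) + u * cnj \<omega> ^ m" unfolding chord by (simp add: algebra_simps)
    finally show "l *\<^sub>R u + u * \<omega> ^ (m + 1) = l *\<^sub>R (u * \<omega>) + u * cnj \<omega> ^ m" .
  qed
  have "\<omega> \<noteq> 1" using sin(1) by (auto simp: \<omega>(3) complex_eq_iff cos_double_sin)
  have label_step: "x * A (l *\<^sub>R u) = y * A (l *\<^sub>R (u * \<omega>))"
    if u: "u \<in> roots k" and xy: "x \<in> roots k" "y \<in> roots k" and eq: "l *\<^sub>R u + x = l *\<^sub>R (u * \<omega>) + y" for u x y
  proof -
    have "u \<noteq> 0" using u kpos by (auto simp: power_0_left)
    then have "u \<noteq> u * \<omega>" using \<open>\<omega> \<noteq> 1\<close> by simp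
    have diff: "q - r = c - b" if "b + q = c + r" for b c q r :: complex
      using that by (simp add: algebra_simps)
    have "d \<le> dist x y"
      using far[OF u step(1)[OF u] \<open>u \<noteq> u * \<omega>\<close>] diff[OF eq]
      by (simp add: dist_norm norm_minus_commute)
    moreover have "x - y = u * \<omega> ^ (m + 1) - u * cnj \<omega> ^ m"
      unfolding diff[OF eq] diff[OF step(4)[OF u]] ..
    \<comment> \<open>Two diametral pairs with the same difference coincide, so the known contact
      point of neighbouring cells is the only one.\<close>
    ultimately have x: "x = u * \<omega> ^ (m + 1)"
      using parallel_diameters_eq[OF diam, of k x y "u * \<omega> ^ (m + 1)" "u * cnj \<omega> ^ m"] xy step[OF u] kpos
      by auto
    then have y: "y = u * cnj \<omega> ^ m" using eq step(4)[OF u] by simp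
    have "cnj \<omega> ^ m * \<omega> ^ h = (\<omega> * cnj \<omega>) ^ m * \<omega> ^ (m + 1)"
      unfolding m by (simp add: power_mult_distrib power_add mult_2)
    then have "cnj \<omega> ^ m * \<omega> ^ h = \<omega> ^ (m + 1)" unfolding \<omega>(2) by simp
    then show ?thesis unfolding A x y by (simp add: power_mult_distrib mult_ac)
  qed
  \<comment> \<open>At a corner the label is \<open>u * u ^ h\<close>, whence the exponent
    \<open>Suc h\<close>.\<close>
  interpret root_system k l d S A "Suc h"
  proof
    show "k \<ge> 3" "l > 0" by fact+
    show "d > 0" using sin by (simp add: d_def)
    show "finite S" using finR by (simp add: S_def)
    show "l *\<^sub>R u \<in> S" if "u \<in> roots k" for u unfolding S_def using that by blast
    show "\<exists>p\<in>convex hull roots k. s = l *\<^sub>R p" if "s \<in> S" for s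
      using that hull_inc[of _ "roots k" convex] unfolding S_def by blast
    show "d \<le> dist s t" if "s \<in> S" "t \<in> S" "s \<noteq> t" for s t
      using that far unfolding S_def by blast
    show "dist u v \<le> d" if "u \<in> roots k" "v \<in> roots k" for u v using that by (rule diam)
    show "u * cnj s \<in> S" if "s \<in> S" "u \<in> roots k" for s u
    proof -
      obtain v where "v \<in> roots k" "s = l *\<^sub>R v" using \<open>s \<in> S\<close> unfolding S_def by blast
      then show ?thesis
        using root_quotient(1)[OF that(2) _ kpos, of v] by (auto simp: S_def)
    qed
    show "A s ^ k = 1" if "s \<in> S" for s
    proof -
      obtain v where v: "v \<in> roots k" "s = l *\<^sub>R v" using \<open>s \<in> S\<close> unfolding S_def by blast
      then have "(v ^ k) ^ h = 1" by simp
      then show ?thesis by (simp add: v A mult.commute flip: power_mult)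
    qed
    show "u * A (l *\<^sub>R u) = u ^ Suc h" for u by (simp add: A)
    show "x * A s = y * A t"
      if st: "s \<in> S" "t \<in> S" "s \<noteq> t" and xy: "x \<in> roots k" "y \<in> roots k" and eq: "s + x = t + y" for s t x y
    proof -
      obtain u v where uv: "u \<in> roots k" "v \<in> roots k" "s = l *\<^sub>R u" "t = l *\<^sub>R v"
        using st unfolding S_def by blast
      have "y - x = s - t" using eq by (simp add: algebra_simps)
      \<comment> \<open>Meeting cells have centers at most \<open>d\<close> apart, so
        \<open>u\<close> and \<open>v\<close> are at most a side apart, hence neighbours.\<close>
      then have "l * dist u v \<le> d"
        using diam[OF xy(2,1)] dist_scaled[of u v] uv by (simp add: dist_norm)
      then have "dist u v \<le> 2 * sin \<alpha>" using l by (metis mult_le_cancel_left_pos)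
      then have "u = v * \<omega> \<or> v = u * \<omega>"
        using neighbours_if_close[OF uv(1,2) _ kpos] st uv by (auto simp: \<alpha>_def \<omega>_def)
      then show ?thesis
        using label_step[OF uv(1) xy] label_step[OF uv(2) xy(2,1)] eq uv by metis
    qed
    let ?E = "{(s, t). s \<in> S \<and> t \<in> S \<and> (\<exists>u\<in>roots k. \<exists>v\<in>roots k. s + u = t + v)}"
    have "(l *\<^sub>R u, l *\<^sub>R (u * \<omega>)) \<in> ?E" if "u \<in> roots k" for u
      using step[OF that] that unfolding S_def by blast
    then have "(l *\<^sub>R 1, l *\<^sub>R u) \<in> ?E\<^sup>*" if "u \<in> roots k" for u
      by (intro roots_cyclic_connected[OF kpos that, where g = "\<lambda>u. l *\<^sub>R u", folded \<omega>_def] r_into_rtrancl)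
    then have hub: "(l *\<^sub>R 1, s) \<in> ?E\<^sup>*" if "s \<in> S" for s
      using that unfolding S_def by blast
    have "sym ?E" by (auto simp: sym_def dest: sym)
    then show "(s, t) \<in> ?E\<^sup>*" if "s \<in> S" "t \<in> S" for s t
      using rtrancl_hub[of ?E S, OF _ hub that] by blast
  qed
  show ?thesis by (rule realization)
qed

text \<open>By the parallelogram law a distance of \<open>2\<close> leaves nothing for
  \<open>x + y\<close>.\<close>

lemma antipodal_if_dist_2:
  fixes x y :: complex
  assumes "norm x = 1" "norm y = 1" "2 \<le> dist x y"
  shows "y = - x"
proof -
  have "(norm (x + y))\<^sup>2 + (norm (x - y))\<^sup>2 = 2 * (norm x)\<^sup>2 + 2 * (norm y)\<^sup>2"
    unfolding cmod_power2 by (simp add: power2_eq_square algebra_simps)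
  moreover have "2\<^sup>2 \<le> (norm (x - y))\<^sup>2" using assms(3) by (intro power_mono) (auto simp: dist_norm)
  ultimately have "(norm (x + y))\<^sup>2 \<le> 0" unfolding assms(1,2) power2_eq_square by linarith
  then have "x + y = 0" by simp
  then show ?thesis by (simp add: add_eq_0_iff)
qed

lemma realization_4_dvd:
  assumes "k \<ge> 3" and dvd4: "4 dvd k"
  shows "\<exists>(N :: nat) L \<nu>. simple_nested_fractal N L \<nu> \<and> card (essential_fixed_points N L \<nu>) = k \<and>
     good_labelling_property N L \<nu>"
proof -
  define \<alpha> where "\<alpha> = pi / k"
  define C where "C = cos (2 * \<alpha>)"
  define T where "T = sin (2 * \<alpha>)"
  \<comment> \<open>\<open>l\<close> and \<open>b\<close> solve the contact equation
    \<open>key\<close>: its imaginary part is \<open>b * T = 2 * C\<close>, its real part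
    \<open>l - 2 * T = b * (1 + C)\<close>.\<close>
  define l where "l = 2 * (1 + C) / T"
  define b where "b = 2 * C / T"
  define \<omega> where "\<omega> = cis (2 * pi / k)"
  have kpos: "k > 0" and k4: "k = 4 \<or> k \<ge> 8" using assms by (auto elim!: dvdE)
  have finR: "finite (roots k)" using kpos by (simp add: finite_roots_unity)
  have \<alpha>: "0 < \<alpha>" "4 * \<alpha> \<le> pi" using k4 kpos by (auto simp: \<alpha>_def field_simps)
  have T: "T > 0" unfolding T_def using \<alpha> by (intro sin_gt_zero) auto
  have C0: "C \<ge> 0" unfolding C_def using \<alpha> by (intro cos_ge_zero) auto
  have CT: "C\<^sup>2 + T\<^sup>2 = 1" by (simp add: C_def T_def)
  have C1: "C \<le> 1" by (simp add: C_def)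
  have half: "1 / 2 < cos x" if "0 \<le> x" "4 * x \<le> pi" for x
    using cos_monotone_0_pi[of x "pi / 3"] that pi_gt_zero by (simp add: cos_60)
  \<comment> \<open>For \<open>k = 4\<close> this gives \<open>b = 0\<close>, and all intermediate
    centers coincide. Otherwise \<open>C > 1 / 2\<close> will keep distinct intermediate centers
    more than \<open>2\<close> apart.\<close>
  have "k = 4 \<longrightarrow> C = 0" by (auto simp: C_def \<alpha>_def)
  moreover have "1 / 2 < C" if "k \<ge> 8"
    unfolding C_def using \<alpha> that by (intro half) (auto simp: \<alpha>_def field_simps)
  ultimately have C: "C = 0 \<or> 1 / 2 < C" using k4 by blast
  have l: "l > 0" and b: "b \<ge> 0" using T C0 by (simp_all add: l_def b_def)
  have \<omega>: "\<omega> \<in> roots k" "\<omega> * cnj \<omega> = 1" "\<omega> = Complex C T"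
    using kpos by (simp_all add: \<omega>_def \<alpha>_def C_def T_def Complex.DeMoivre cis_mult cis_cnj)
      (simp add: complex_eq_iff)
  have i: "\<i> ^ k = 1" "(- 1 :: complex) ^ k = 1" using dvd4 by (auto elim!: dvdE simp: power_mult)
  define M where "M u = b *\<^sub>R (u * (1 + \<omega>))" for u
  define S where "S = (\<lambda>u. l *\<^sub>R u) ` roots k \<union> M ` roots k"
  define A where "A s = (if s \<in> (\<lambda>u. l *\<^sub>R u) ` roots k then 1 else - 1 :: complex)" for s
  have key: "l *\<^sub>R 1 + \<i> * \<omega> = b *\<^sub>R (1 + \<omega>) + - (\<i> * \<omega>)"
  proof -
    have "b * T = 2 * C" using T by (simp add: b_def)
    moreover have "l - 2 * T = b * (1 + C)"
    proof -
      have "l * T = 2 * (1 + C)" "b * T = 2 * C" using T by (simp_all add: l_def b_def)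
      then have "T * (l - 2 * T) = T * (b * (1 + C))" using CT by algebra
      then show ?thesis using T by simp
    qed
    ultimately show ?thesis unfolding \<omega>(3) by (simp add: complex_eq_iff algebra_simps)
  qed
  have link1: "l *\<^sub>R u + \<i> * \<omega> * u = M u + - (\<i> * \<omega> * u)" for u
    using arg_cong[OF key, of "\<lambda>z. u * z"] by (simp add: M_def algebra_simps)
  \<comment> \<open>Conjugation followed by the factor \<open>u * \<omega>\<close> takes
    \<open>1\<close> to \<open>u * \<omega>\<close> and \<open>1 + \<omega>\<close> to
    \<open>u * (1 + \<omega>)\<close>, so \<open>key\<close> turns into the contact on the other
    side of the intermediate cell.\<close>
  have link2: "l *\<^sub>R (u * \<omega>) + - (\<i> * u) = M u + \<i> * u" for u
  proof -
    have "u * \<omega> * cnj (l *\<^sub>R 1 + \<i> * \<omega>) = u * \<omega> * cnj (b *\<^sub>R (1 + \<omega>) + - (\<i> * \<omega>))"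
      unfolding key ..
    then have "l *\<^sub>R (u * \<omega>) - \<i> * u * (\<omega> * cnj \<omega>)
      = b *\<^sub>R (u * (\<omega> + (\<omega> * cnj \<omega>))) + \<i> * u * (\<omega> * cnj \<omega>)"
      by (simp add: algebra_simps)
    then show ?thesis by (simp add: \<omega>(2) M_def add.commute)
  qed
  have mem: "u * \<omega> \<in> roots k" "\<i> * \<omega> * u \<in> roots k" "- (\<i> * \<omega> * u) \<in> roots k"
    "\<i> * u \<in> roots k" "- (\<i> * u) \<in> roots k" if "u \<in> roots k" for u
  proof -
    have "(- z) ^ k = z ^ k" for z :: complex using i(2) by (metis mult_1 mult_minus1 power_mult_distrib)
    then show "u * \<omega> \<in> roots k" "\<i> * \<omega> * u \<in> roots k" "- (\<i> * \<omega> * u) \<in> roots k"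
      "\<i> * u \<in> roots k" "- (\<i> * u) \<in> roots k"
      using that \<omega>(1) i(1) by (simp_all add: power_mult_distrib)
  qed
  have norm_\<omega>: "norm (1 + \<omega>) = 2 * cos \<alpha>"
  proof (rule power2_eq_imp_eq)
    have "(norm (1 + \<omega>))\<^sup>2 = 2 + 2 * C"
      using CT unfolding cmod_power2 \<omega>(3) by (simp add: power2_eq_square algebra_simps)
    also have "\<dots> = (2 * cos \<alpha>)\<^sup>2" by (simp add: C_def cos_double_cos)
    finally show "(norm (1 + \<omega>))\<^sup>2 = (2 * cos \<alpha>)\<^sup>2" .
    show "0 \<le> 2 * cos \<alpha>" using half[of \<alpha>] \<alpha> by simp
  qed simp
  have ge: "2 * sin \<alpha> \<le> dist u v" if "u \<in> roots k" "v \<in> roots k" "u \<noteq> v" for u v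
    using dist_roots_ge[OF that kpos] by (simp add: \<alpha>_def)
  have corner_corner: "2 < dist (l *\<^sub>R u) (l *\<^sub>R v)" if "u \<in> roots k" "v \<in> roots k" "u \<noteq> v" for u v
  proof -
    have "T * (l * (2 * sin \<alpha>)) = T * (4 * cos \<alpha>)"
      using T unfolding l_def C_def by (simp add: cos_double_cos T_def sin_double power2_eq_square)
    then have "4 * cos \<alpha> = l * (2 * sin \<alpha>)" using T by simp
    also have "\<dots> \<le> l * dist u v" using ge[OF that] l by (intro mult_left_mono) auto
    also have "\<dots> = dist (l *\<^sub>R u) (l *\<^sub>R v)" using l by (simp add: dist_norm flip: scaleR_diff_right)
    finally show ?thesis using half[of \<alpha>] \<alpha> by simp
  qed
  have mid_mid: "2 < dist (M u) (M v)" if "u \<in> roots k" "v \<in> roots k" "M u \<noteq> M v" for u v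
  proof -
    have "b \<noteq> 0" using that(3) by (auto simp: M_def)
    then have "1 / 2 < C" using C by (auto simp: b_def)
    have "u \<noteq> v" using that(3) by auto
    have "4 * C = 2 * (b * T)" using T by (simp add: b_def)
    also have "\<dots> = b * (2 * cos \<alpha>) * (2 * sin \<alpha>)" by (simp add: T_def sin_double)
    also have "\<dots> \<le> b * (2 * cos \<alpha>) * dist u v"
      using ge[OF that(1,2) \<open>u \<noteq> v\<close>] b half[of \<alpha>] \<alpha> by (intro mult_left_mono) auto
    also have "\<dots> = dist (M u) (M v)"
    proof -
      have "M u - M v = b *\<^sub>R ((u - v) * (1 + \<omega>))" by (simp add: M_def algebra_simps)
      then show ?thesis using b by (simp add: dist_norm norm_mult norm_\<omega>)
    qed
    finally show ?thesis using \<open>1 / 2 < C\<close> by simp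
  qed
  \<comment> \<open>Rotate the corner center to \<open>l\<close>. All intermediate centers have the
    same norm, so a nearest one has the largest real part; \<open>y\<close> attains it, and
    \<open>key\<close> gives its distance as exactly \<open>2\<close>.\<close>
  have corner_mid: "2 \<le> dist (l *\<^sub>R u) (M v)" if "u \<in> roots k" "v \<in> roots k" for u v
  proof -
    define r where "r = v * cnj u"
    have r: "r \<in> roots k" "v = r * u"
      using root_quotient[OF that(2,1) kpos] by (simp_all add: r_def)
    define x y where "x = b *\<^sub>R (r * (1 + \<omega>))" and "y = b *\<^sub>R (1 + \<omega>)"
    have "Re r + Re (r * \<omega>) \<le> 1 + C"
    proof (cases "r = 1")
      case False
      have "Re (r * \<omega>) \<le> norm (r * \<omega>)" by (rule complex_Re_le_cmod)
      also have "\<dots> = 1" using norm_root[OF r(1) kpos] norm_root[OF \<omega>(1) kpos] by (simp add: norm_mult)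
      finally show ?thesis
        using Re_root_le[OF r(1) False kpos] by (simp add: C_def \<alpha>_def)
    qed (simp add: \<omega>(3))
    then have "b * Re (r * (1 + \<omega>)) \<le> b * (1 + C)" using b by (intro mult_left_mono) (auto simp: algebra_simps)
    then have Re: "Re x \<le> Re y" by (simp add: x_def y_def \<omega>(3))
    have norm_eq: "norm x = norm y"
      using norm_root[OF r(1) kpos] by (simp add: x_def y_def norm_mult)
    have sq: "(norm (of_real l - z))\<^sup>2 = l\<^sup>2 - 2 * l * Re z + (norm z)\<^sup>2" for z
      unfolding cmod_power2 by (simp add: power2_eq_square algebra_simps)
    have "of_real l - y = - 2 * (\<i> * \<omega>)"
      using key by (simp add: y_def scaleR_conv_of_real algebra_simps)
    then have "norm (of_real l - y) = norm (- 2 * (\<i> * \<omega>))" by simp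
    then have "norm (of_real l - y) = 2"
      using norm_root[OF \<omega>(1) kpos] by (simp add: norm_mult)
    moreover have "2 * l * Re x \<le> 2 * l * Re y" using Re l by (intro mult_left_mono) auto
    ultimately have "2\<^sup>2 \<le> (norm (of_real l - x))\<^sup>2"
      unfolding sq norm_eq using sq[of y] by simp
    then have "2 \<le> norm (of_real l - x)" by (rule power2_le_imp_le) simp
    also have "\<dots> = norm (u * (of_real l - x))"
      using norm_root[OF that(1) kpos] by (simp add: norm_mult)
    also have "u * (of_real l - x) = l *\<^sub>R u - M v"
      by (simp add: x_def M_def r(2) scaleR_conv_of_real algebra_simps)
    finally show ?thesis by (simp add: dist_norm)
  qed
  have A_corner: "A (l *\<^sub>R u) = 1" if "u \<in> roots k" for u using that by (auto simp: A_def)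
  \<comment> \<open>\<open>A\<close> tests for being a corner center, so the two kinds of centers
    must be disjoint; \<open>corner_mid\<close> gives this.\<close>
  have A_mid: "A (M u) = - 1" if "u \<in> roots k" for u
  proof -
    have "M u \<noteq> l *\<^sub>R v" if "v \<in> roots k" for v
      using corner_mid[OF that \<open>u \<in> roots k\<close>] by auto
    then show ?thesis unfolding A_def by auto
  qed
  have S_cases: "(\<exists>u\<in>roots k. s = l *\<^sub>R u) \<or> (\<exists>u\<in>roots k. s = M u)" if "s \<in> S" for s
    using that unfolding S_def by blast
  \<comment> \<open>Corner cells carry no rotation, so the exponent is \<open>1\<close>.\<close>
  interpret root_system k l 2 S A 1
  proof
    show "k \<ge> 3" "l > 0" by fact+
    show "finite S" using finR by (simp add: S_def)
    show "l *\<^sub>R u \<in> S" if "u \<in> roots k" for u unfolding S_def using that by blast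
    show "\<exists>p\<in>convex hull roots k. s = l *\<^sub>R p" if "s \<in> S" for s
      using S_cases[OF that]
    proof
      assume "\<exists>u\<in>roots k. s = l *\<^sub>R u"
      then show ?thesis using hull_inc[of _ "roots k" convex] by blast
    next
      assume "\<exists>u\<in>roots k. s = M u"
      then obtain u where u: "u \<in> roots k" "s = M u" by blast
      \<comment> \<open>\<open>M u\<close> is \<open>2 * b\<close> times the midpoint of a side; as
        \<open>2 * b \<le> l\<close>, it lies between the origin and \<open>l\<close> times that
        midpoint.\<close>
      define t where "t = 2 * b / l"
      have "2 * b \<le> l" using C1 T by (simp add: b_def l_def divide_right_mono)
      then have t: "0 \<le> t" "t \<le> 1" using b l by (simp_all add: t_def)
      have "midpoint u (u * \<omega>) \<in> convex hull roots k"
        using u mem(1)[of u] by (intro midpoints_in_convex_hull hull_inc)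
      then have "(1 - t) *\<^sub>R 0 + t *\<^sub>R midpoint u (u * \<omega>) \<in> convex hull roots k"
        using t zero_in_hull_roots[of k] \<open>k \<ge> 3\<close> by (intro convexD) auto
      moreover have "s = l *\<^sub>R ((1 - t) *\<^sub>R 0 + t *\<^sub>R midpoint u (u * \<omega>))"
        using l by (simp add: u t_def M_def midpoint_def algebra_simps)
      ultimately show ?thesis by blast
    qed
    show "2 \<le> dist s t" if "s \<in> S" "t \<in> S" "s \<noteq> t" for s t
      using S_cases[OF that(1)] S_cases[OF that(2)] that(3) corner_corner mid_mid corner_mid
      by (metis dist_commute less_imp_le)
    show "dist u v \<le> 2" if "u \<in> roots k" "v \<in> roots k" for u v
      using norm_triangle_ineq4[of u v] that kpos norm_root by (simp add: dist_norm)
    show "u * cnj s \<in> S" if "s \<in> S" "u \<in> roots k" for s u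
      using S_cases[OF that(1)]
    proof
      assume "\<exists>v\<in>roots k. s = l *\<^sub>R v"
      then obtain v where "v \<in> roots k" "s = l *\<^sub>R v" by blast
      then show ?thesis
        using root_quotient(1)[OF that(2) _ kpos, of v] by (auto simp: S_def)
    next
      assume "\<exists>v\<in>roots k. s = M v"
      then obtain v where v: "v \<in> roots k" "s = M v" by blast
      have "u * cnj v * cnj \<omega> \<in> roots k"
        using v(1) that(2) \<omega>(1) kpos root_quotient(1) by blast
      moreover have "u * cnj s = M (u * cnj v * cnj \<omega>)"
      proof -
        have "M (u * cnj v * cnj \<omega>) = b *\<^sub>R (u * cnj v * (cnj \<omega> + \<omega> * cnj \<omega>))"
          by (simp add: M_def algebra_simps)
        then show ?thesis by (simp add: \<omega>(2) v M_def algebra_simps)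
      qed
      ultimately show ?thesis by (auto simp: S_def)
    qed
    show "A s ^ k = 1" if "s \<in> S" for s using i(2) by (simp add: A_def)
    show "u * A (l *\<^sub>R u) = u ^ 1" if "u \<in> roots k" for u using A_corner[OF that] by simp
    show "x * A s = y * A t"
      if st: "s \<in> S" "t \<in> S" "s \<noteq> t" and xy: "x \<in> roots k" "y \<in> roots k" and eq: "s + x = t + y" for s t x y
    proof -
      have "y - x = s - t" using eq by (simp add: algebra_simps)
      then have dist: "dist x y = dist s t" by (metis dist_commute dist_norm)
      then have le: "dist s t \<le> 2"
        using norm_triangle_ineq4[of x y] xy kpos norm_root by (simp add: dist_norm)
      have anti: "y = - x" if "2 \<le> dist s t"
        using antipodal_if_dist_2[of x y] xy kpos norm_root that dist by simp
      \<comment> \<open>Distinct centers of the same kind are too far apart for contact. Cells of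
        different kinds meet only in antipodal vertices, whose labels are matched by the half
        turn.\<close>
      consider u v where "u \<in> roots k" "v \<in> roots k" "s = l *\<^sub>R u" "t = l *\<^sub>R v"
        | u v where "u \<in> roots k" "v \<in> roots k" "s = M u" "t = M v"
        | u v where "u \<in> roots k" "v \<in> roots k" "s = l *\<^sub>R u" "t = M v"
        | u v where "u \<in> roots k" "v \<in> roots k" "s = M u" "t = l *\<^sub>R v"
        using S_cases[OF st(1)] S_cases[OF st(2)] by metis
      then show ?thesis
      proof cases
        case 1
        then show ?thesis using corner_corner[of u v] st(3) le by auto
      next
        case 2
        then show ?thesis using mid_mid[of u v] st(3) le by auto
      next
        case 3
        then show ?thesis using corner_mid[of u v] A_corner[of u] A_mid[of v] anti by simp
      next
        case 4
        then show ?thesis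
          using corner_mid[of v u] A_corner[of v] A_mid[of u] anti by (simp add: dist_commute)
      qed
    qed
    let ?E = "{(s, t). s \<in> S \<and> t \<in> S \<and> (\<exists>u\<in>roots k. \<exists>v\<in>roots k. s + u = t + v)}"
    have sym: "sym ?E" by (auto simp: sym_def dest: sym)
    have E1: "(l *\<^sub>R u, M u) \<in> ?E" if "u \<in> roots k" for u
      using link1[of u] mem(2,3)[OF that] that unfolding S_def by blast
    have E2: "(l *\<^sub>R (u * \<omega>), M u) \<in> ?E" if "u \<in> roots k" for u
      using link2[of u] mem(1,4,5)[OF that] that unfolding S_def by blast
    have hub: "(l *\<^sub>R 1, l *\<^sub>R u) \<in> ?E\<^sup>*" if "u \<in> roots k" for u
    proof (rule roots_cyclic_connected[OF kpos that, where g = "\<lambda>u. l *\<^sub>R u", folded \<omega>_def])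
      fix u assume "u \<in> roots k"
      then show "(l *\<^sub>R u, l *\<^sub>R (u * \<omega>)) \<in> ?E\<^sup>*"
        using E1 symD[OF sym E2] by (meson r_into_rtrancl rtrancl_into_rtrancl)
    qed
    have hub': "(l *\<^sub>R 1, s) \<in> ?E\<^sup>*" if "s \<in> S" for s
      using S_cases[OF that] hub rtrancl_into_rtrancl[OF hub E1] by blast
    show "(s, t) \<in> ?E\<^sup>*" if "s \<in> S" "t \<in> S" for s t
      by (rule rtrancl_hub[of ?E S, OF sym hub' that])
  qed simp
  show ?thesis by (rule realization)
qed

theorem mainTheorem6:
  fixes k :: nat
  assumes "k \<ge> 3"
  shows "\<exists>(N :: nat) (L :: real) (\<nu> :: nat \<Rightarrow> complex).
           simple_nested_fractal N L \<nu> \<and>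
           card (essential_fixed_points N L \<nu>) = k \<and>
           good_labelling_property N L \<nu>"
  using realization_4_dvd realization_not_4_dvd assms by blast

end
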